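(* Let $G_1$ and $G_2$ be compact Lie groups and $G=G_1\times G_2$. Let $u$ be a linear functional on the span of the functions $\varphi\times\overline{\eta_{sr}}$, $\varphi\in\Gamma_{(M_k)}(G_1)$, $[\eta]\in\widehat{G_2}$, $1\le r,s\le d_\eta$. Then $u\in\Gamma'_{(M_k)}(G)$ (that is, $u$ is the restriction of an element of $\Gamma'_{(M_k)}(G)$) if and only if there exist $\varepsilon,h,C>0$ such that $$|\langle\widehat u(\,\cdot\,,\eta)_{rs},\varphi\rangle|\le C\,\|\varphi\|_h\exp\{M(\varepsilon\langle\eta\rangle)\}$$ for all $\varphi\in\Gamma_{(M_k)}(G_1)$, all $[\eta]\in\widehat{G_2}$ and all $1\le r,s\le d_\eta$, where $$\|\varphi\|_h:=\sup_{\alpha\in\mathbb N_0^{\dim G_1},\,x_1\in G_1}|\partial^\alpha\varphi(x_1)|\,h^{-|\alpha|}M_{|\alpha|}^{-1}.$$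
   Context: Sequence: $\{M_k\}_{k\in\mathbb N_0}$ is a sequence of positive numbers such that for some $H>0$, $B\ge 1$: (M.0) $M_0=1$; (M.1) $M_{k+1}\le BH^kM_k$ for all $k\ge0$; (M.2) $M_{2k}\le BH^{2k}M_k^2$ for all $k\ge 0$; (M.3') for every $\ell>0$ there is $c_\ell>0$ with $k!\le c_\ell\,\ell^kM_k$ for all $k\ge0$; (M.4) $\frac{M_r}{r!}\frac{M_s}{s!}\le\frac{M_{r+s}}{(r+s)!}$ for all $r,s\ge0$; (LC) $M_k^2\le M_{k-1}M_{k+1}$ for all $k\ge1$. Its associated function is $M(r)=\sup_{k\in\mathbb N_0}\log\frac{r^k}{M_k}$ for $r>0$, $M(0)=0$. Groups: for a compact Lie group $K$ with normalized Haar measure, $\widehat K$ is the set of equivalence classes of continuous irreducible unitary representations; one matrix representative $\phi=(\phi_{ij})$ of dimension $d_\phi$ is fixed in each class. $\mathcal L_K$ is the Laplace-Beltrami operator (for a bi-invariant metric), $-\mathcal L_K\phi_{ij}=\nu_{[\phi]}\phi_{ij}$ with $\nu_{[\phi]}\ge 0$, and $\langle\phi\rangle=(1+\nu_{[\phi]})^{1/2}$. Derivatives: fix a basis $Y_1,\dots,Y_d$ of the Lie algebra of $K$ orthonormal for that metric, acting as left-invariant vector fields (on $G_1\times G_2$ use the union of the bases of the factors). For $\alpha\in\mathbb N_0^d$, $\partial^\alpha$ denotes a composition of these vector fields in which each $Y_j$ enters exactly $\alpha_j$ times; estimates and suprema are understood over every order of composition. Beurling class: $\Gamma_{(M_k)}(K)$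 is the set of $f\in C^\infty(K)$ (complex valued) such that for every $h>0$ there exists $C_h>0$ with $\|\partial^\alpha f\|_{L^2(K)}\le C_hh^{|\alpha|}M_{|\alpha|}$ for all $\alpha$ (the $L^\infty$ norm gives the same space). The space of ultradistributions $\Gamma'_{(M_k)}(K)$ consists of the linear functionals $u$ on $\Gamma_{(M_k)}(K)$ for which there exist $\ell,C>0$ with $|\langle u,\psi\rangle|\le C\sup_\alpha \ell^{|\alpha|}M_{|\alpha|}^{-1}\|\partial^\alpha\psi\|_{L^\infty(K)}$ for all $\psi\in\Gamma_{(M_k)}(K)$. Fourier characterization, which may be taken as known: an ultradistribution is determined by its Fourier coefficients $\langle u,\overline{\phi_{ji}}\rangle$, and a family of numbers is the family of Fourier coefficients of an element of $\Gamma'_{(M_k)}(G)$ if and only if there are $N,C>0$ with all entries at $([\xi],[\eta])\in\widehat{G_1}\times\widehat{G_2}$ bounded by $C\exp\{M(N(\langle\xi\rangle+\langle\eta\rangle))\}$. Notation: $(\varphi\times\psi)(x_1,x_2)=\varphi(x_1)\psi(x_2)$, and the partial Fourier coefficients of $u$ are the functionals $\langle\widehat u(\,\cdot\,,\eta)_{rs},\varphi\rangle:=\langle u,\varphi\times\overline{\eta_{sr}}\rangle$, $\varphi\in\Gamma_{(M_k)}(G_1)$. *)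

theory Defs
  imports
    "HOL-Probability.Probability"
    "HOL-Algebra.Group"
    "Jordan_Normal_Form.Schur_Decomposition"
    "Jordan_Normal_Form.VS_Connect"
begin

section \<open>Smooth manifolds\<close>

text \<open>
  Charts take values in \<^const>\<open>Euclidean_space\<close> \<open>n\<close>, i.e. in the sequences that vanish from index
  \<open>n\<close> on. The case \<open>n = 0\<close> (discrete manifolds, finite groups) is included. Only
  the values of a chart on its domain matter, so a chart is stored together with its domain.
\<close>

type_synonym 'a chart = "'a set \<times> ('a \<Rightarrow> nat \<Rightarrow> real)"

definition partial_deriv ::
    "nat \<Rightarrow> ((nat \<Rightarrow> real) \<Rightarrow> 'b::real_normed_vector) \<Rightarrow> (nat \<Rightarrow> real) \<Rightarrow> 'b" where
  "partial_deriv i f = (\<lambda>x. vector_derivative (\<lambda>t. f (x(i := t))) (at (x i)))"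

text \<open>On a (relatively) open set \<open>V\<close>: all iterated partial derivatives exist and are continuous.\<close>

definition smooth_on_coord ::
    "nat \<Rightarrow> (nat \<Rightarrow> real) set \<Rightarrow> ((nat \<Rightarrow> real) \<Rightarrow> 'b::real_normed_vector) \<Rightarrow> bool" where
  "smooth_on_coord n V f \<longleftrightarrow>
     (\<forall>w \<in> lists {..<n}.
        continuous_on V (foldr partial_deriv w f) \<and>
        (\<forall>x\<in>V. \<forall>i<n. (\<lambda>t. foldr partial_deriv w f (x(i := t))) differentiable (at (x i))))"

definition is_chart :: "nat \<Rightarrow> 'a::topological_space chart \<Rightarrow> bool" where
  "is_chart n = (\<lambda>(U, \<kappa>). open U \<and> openin (Euclidean_space n) (\<kappa> ` U) \<and>
     homeomorphic_map (top_of_set U) (subtopology (Euclidean_space n) (\<kappa> ` U)) \<kappa>)"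

definition smooth_atlas :: "nat \<Rightarrow> 'a::topological_space chart set \<Rightarrow> bool" where
  "smooth_atlas n A \<longleftrightarrow>
     (\<forall>c\<in>A. is_chart n c) \<and> (\<Union>c\<in>A. fst c) = UNIV \<and>
     (\<forall>(U, \<kappa>)\<in>A. \<forall>(U', \<kappa>')\<in>A. \<forall>i<n.
        smooth_on_coord n (\<kappa> ` (U \<inter> U')) (\<lambda>y. \<kappa>' (inv_into U \<kappa> y) i))"

definition smooth_map ::
    "nat \<Rightarrow> 'a::topological_space chart set \<Rightarrow> nat \<Rightarrow> 'b::topological_space chart set
      \<Rightarrow> ('a \<Rightarrow> 'b) \<Rightarrow> bool" where
  "smooth_map n A m B F \<longleftrightarrow> continuous_on UNIV F \<and>
     (\<forall>(U, \<kappa>)\<in>A. \<forall>(V, \<tau>)\<in>B. \<forall>j<m.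
        smooth_on_coord n (\<kappa> ` (U \<inter> F -` V)) (\<lambda>y. \<tau> (F (inv_into U \<kappa> y)) j))"

definition smooth_functions :: "nat \<Rightarrow> 'a chart set \<Rightarrow> ('a \<Rightarrow> complex) set" where
  "smooth_functions n A =
     {f. \<forall>(U, \<kappa>)\<in>A. smooth_on_coord n (\<kappa> ` U) (\<lambda>y. f (inv_into U \<kappa> y))}"

definition prod_atlas :: "nat \<Rightarrow> 'a chart set \<Rightarrow> 'b chart set \<Rightarrow> ('a \<times> 'b) chart set" where
  "prod_atlas n A B =
     {(U \<times> V, \<lambda>(x, y) i. if i < n then \<kappa> x i else \<tau> y (i - n)) | U \<kappa> V \<tau>. (U, \<kappa>) \<in> A \<and> (V, \<tau>) \<in> B}"


section \<open>Compact Lie groups, invariant vector fields, Laplace-Beltrami operator\<close>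

text \<open>
  The underlying set of the group is a whole type, whose class provides the (Hausdorff, second
  countable) topology. Functions on the group are then exactly the functions on that type.
\<close>

locale compact_lie_group = group G
  for G :: "'a::{second_countable_topology, t2_space} monoid" (structure) +
  fixes n :: nat and A :: "'a chart set"
  assumes carrier_UNIV: "carrier G = UNIV"
    and atlas: "smooth_atlas n A"
    and smooth_mult: "smooth_map (n + n) (prod_atlas n A A) n A (\<lambda>(x, y). x \<otimes> y)"
    and smooth_inv: "smooth_map n A n A (\<lambda>x. inv x)"
    and compact_UNIV: "compact (UNIV :: 'a set)"

definition haar_measure :: "'a::topological_space monoid \<Rightarrow> 'a measure \<Rightarrow> bool" where
  "haar_measure G \<mu> \<longleftrightarrow> sets \<mu> = sets borel \<and> prob_space \<mu> \<and>
     (\<forall>g. distr \<mu> borel (\<lambda>x. g \<otimes>\<^bsub>G\<^esub> x) = \<mu> \<and> distr \<mu> borel (\<lambda>x. x \<otimes>\<^bsub>G\<^esub> g) = \<mu>)"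

type_synonym 'a operator = "('a \<Rightarrow> complex) \<Rightarrow> ('a \<Rightarrow> complex)"

text \<open>
  The Lie algebra, as the left-invariant real vector fields, i.e. the left-invariant derivations of
  \<open>C\<^sup>\<infinity>(G)\<close> that commute with complex conjugation. An operator has to be a total function in HOL; it
  is normalised to 0 outside \<open>C\<^sup>\<infinity>(G)\<close>, so that vector fields that agree on \<open>C\<^sup>\<infinity>(G)\<close> are equal.
\<close>

definition lie_algebra :: "'a monoid \<Rightarrow> nat \<Rightarrow> 'a chart set \<Rightarrow> 'a operator set" where
  "lie_algebra G n A = (let S = smooth_functions n A in
     {X. (\<forall>f. f \<notin> S \<longrightarrow> X f = (\<lambda>_. 0)) \<and>
         (\<forall>f\<in>S. X f \<in> S) \<and>
         (\<forall>f\<in>S. \<forall>g\<in>S. X (\<lambda>x. f x + g x) = (\<lambda>x. X f x + X g x)) \<and>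
         (\<forall>f\<in>S. \<forall>c. X (\<lambda>x. c * f x) = (\<lambda>x. c * X f x)) \<and>
         (\<forall>f\<in>S. \<forall>g\<in>S. X (\<lambda>x. f x * g x) = (\<lambda>x. X f x * g x + f x * X g x)) \<and>
         (\<forall>f\<in>S. X (\<lambda>x. cnj (f x)) = (\<lambda>x. cnj (X f x))) \<and>
         (\<forall>f\<in>S. \<forall>g. X (\<lambda>x. f (g \<otimes>\<^bsub>G\<^esub> x)) = (\<lambda>x. X f (g \<otimes>\<^bsub>G\<^esub> x)))})"

definition lie_bracket :: "'a operator \<Rightarrow> 'a operator \<Rightarrow> 'a operator" where
  "lie_bracket X Z = (\<lambda>f x. X (Z f) x - Z (X f) x)"

definition Ad :: "'a monoid \<Rightarrow> 'a \<Rightarrow> 'a operator \<Rightarrow> 'a operator" where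
  "Ad G g X = (\<lambda>f x. X (\<lambda>y. f (y \<otimes>\<^bsub>G\<^esub> inv\<^bsub>G\<^esub> g)) (x \<otimes>\<^bsub>G\<^esub> g))"

text \<open>
  A left-invariant Riemannian metric is given by its (constant) values on pairs of left-invariant
  vector fields, i.e. by an inner product on the Lie algebra. It is also right-invariant iff that
  inner product is invariant under the adjoint action.
\<close>

definition biinvariant_metric ::
    "'a monoid \<Rightarrow> nat \<Rightarrow> 'a chart set \<Rightarrow> ('a operator \<Rightarrow> 'a operator \<Rightarrow> real) \<Rightarrow> bool" where
  "biinvariant_metric G n A ip \<longleftrightarrow> (let L = lie_algebra G n A in
     (\<forall>X\<in>L. \<forall>Z\<in>L. ip X Z = ip Z X) \<and>
     (\<forall>X\<in>L. \<forall>X'\<in>L. \<forall>Z\<in>L. ip (\<lambda>f x. X f x + X' f x) Z = ip X Z + ip X' Z) \<and>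
     (\<forall>X\<in>L. \<forall>Z\<in>L. \<forall>c. ip (\<lambda>f x. of_real c * X f x) Z = c * ip X Z) \<and>
     (\<forall>X\<in>L. X \<noteq> (\<lambda>f x. 0) \<longrightarrow> 0 < ip X X) \<and>
     (\<forall>X\<in>L. \<forall>Z\<in>L. \<forall>g. ip (Ad G g X) (Ad G g Z) = ip X Z))"

definition orthonormal_basis ::
    "'a monoid \<Rightarrow> nat \<Rightarrow> 'a chart set \<Rightarrow> ('a operator \<Rightarrow> 'a operator \<Rightarrow> real)
      \<Rightarrow> (nat \<Rightarrow> 'a operator) \<Rightarrow> bool" where
  "orthonormal_basis G n A ip Y \<longleftrightarrow>
     (\<forall>j<n. Y j \<in> lie_algebra G n A) \<and>
     (\<forall>i<n. \<forall>j<n. ip (Y i) (Y j) = (if i = j then 1 else 0)) \<and>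
     (\<forall>X \<in> lie_algebra G n A. \<exists>c :: nat \<Rightarrow> real. X = (\<lambda>f x. \<Sum>j<n. of_real (c j) * Y j f x))"

text \<open>
  The number \<open>\<langle>\<nabla>\<^sub>X Z, W\<rangle>\<close> for the Levi-Civita connection and left-invariant fields: Koszul's
  formula, in which the derivatives of the (constant) inner products vanish.
\<close>

definition levi_civita ::
    "('a operator \<Rightarrow> 'a operator \<Rightarrow> real) \<Rightarrow> 'a operator \<Rightarrow> 'a operator \<Rightarrow> 'a operator \<Rightarrow> real" where
  "levi_civita ip X Z W =
     (ip (lie_bracket X Z) W - ip (lie_bracket Z W) X + ip (lie_bracket W X) Z) / 2"

text \<open>
  The divergence \<open>\<Sum>\<^sub>j \<langle>\<nabla>\<^bsub>Y\<^sub>j\<^esub> Z, Y\<^sub>j\<rangle>\<close> of the vector field \<open>Z = \<Sum>\<^sub>k a\<^sub>k Y\<^sub>k\<close> with function coefficients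
  \<open>a\<^sub>k\<close>, for an orthonormal left-invariant frame \<open>Y\<close>. In that frame the gradient of \<open>f\<close> has the
  coefficients \<open>Y\<^sub>k f\<close>, and the Laplace-Beltrami operator is the divergence of the gradient.
\<close>

definition divergence ::
    "nat \<Rightarrow> ('a operator \<Rightarrow> 'a operator \<Rightarrow> real) \<Rightarrow> (nat \<Rightarrow> 'a operator)
      \<Rightarrow> (nat \<Rightarrow> 'a \<Rightarrow> complex) \<Rightarrow> 'a \<Rightarrow> complex" where
  "divergence n ip Y a = (\<lambda>x. (\<Sum>j<n. Y j (a j) x) +
     (\<Sum>k<n. a k x * of_real (\<Sum>j<n. levi_civita ip (Y j) (Y k) (Y j))))"

definition laplace_beltrami ::
    "nat \<Rightarrow> ('a operator \<Rightarrow> 'a operator \<Rightarrow> real) \<Rightarrow> (nat \<Rightarrow> 'a operator) \<Rightarrow> 'a operator" where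
  "laplace_beltrami n ip Y f = divergence n ip Y (\<lambda>k. Y k f)"


section \<open>Unitary dual\<close>

definition rep_dim :: "'a monoid \<Rightarrow> ('a \<Rightarrow> complex mat) \<Rightarrow> nat" where
  "rep_dim G \<phi> = dim_row (\<phi> \<one>\<^bsub>G\<^esub>)"

definition unitary_rep :: "'a::topological_space monoid \<Rightarrow> ('a \<Rightarrow> complex mat) \<Rightarrow> bool" where
  "unitary_rep G \<phi> \<longleftrightarrow> (let d = rep_dim G \<phi> in
     (\<forall>x. \<phi> x \<in> carrier_mat d d \<and> \<phi> x * mat_adjoint (\<phi> x) = 1\<^sub>m d) \<and>
     (\<forall>x y. \<phi> (x \<otimes>\<^bsub>G\<^esub> y) = \<phi> x * \<phi> y) \<and>
     (\<forall>i<d. \<forall>j<d. continuous_on UNIV (\<lambda>x. \<phi> x $$ (i, j))))"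

definition irreducible_rep :: "'a monoid \<Rightarrow> ('a \<Rightarrow> complex mat) \<Rightarrow> bool" where
  "irreducible_rep G \<phi> \<longleftrightarrow> (let d = rep_dim G \<phi> in d > 0 \<and>
     (\<forall>W. VectorSpace.subspace class_ring W (module_vec TYPE(complex) d) \<and>
          (\<forall>x. \<forall>v\<in>W. \<phi> x *\<^sub>v v \<in> W) \<longrightarrow> W = {0\<^sub>v d} \<or> W = carrier_vec d))"

definition equivalent_rep :: "'a monoid \<Rightarrow> ('a \<Rightarrow> complex mat) \<Rightarrow> ('a \<Rightarrow> complex mat) \<Rightarrow> bool" where
  "equivalent_rep G \<phi> \<psi> \<longleftrightarrow> (let d = rep_dim G \<phi> in rep_dim G \<psi> = d \<and>
     (\<exists>T \<in> carrier_mat d d. invertible_mat T \<and> (\<forall>x. T * \<phi> x = \<psi> x * T)))"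

text \<open>
  The unitary dual is handled through a set \<open>R\<close> that contains exactly one matrix representation of
  each equivalence class; quantifying over \<open>R\<close> is quantifying over the dual.
\<close>

definition dual_representatives ::
    "'a::topological_space monoid \<Rightarrow> ('a \<Rightarrow> complex mat) set \<Rightarrow> bool" where
  "dual_representatives G R \<longleftrightarrow>
     (\<forall>\<phi>\<in>R. unitary_rep G \<phi> \<and> irreducible_rep G \<phi>) \<and>
     (\<forall>\<psi>. unitary_rep G \<psi> \<and> irreducible_rep G \<psi> \<longrightarrow> (\<exists>!\<phi>. \<phi> \<in> R \<and> equivalent_rep G \<phi> \<psi>))"

text \<open>
  A compact Lie group with the choices made in its Fourier analysis: normalised Haar measure \<open>\<mu>\<close>,
  bi-invariant metric \<open>ip\<close>, orthonormal basis \<open>Y\<close>, representatives \<open>R\<close>, and the eigenvalues \<open>\<nu>\<close> of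
  \<open>-L\<close> on the (smooth) matrix entries.
\<close>

locale compact_lie_group_fourier = compact_lie_group G n A
  for G :: "'a::{second_countable_topology, t2_space} monoid" (structure)
    and n :: nat and A :: "'a chart set" +
  fixes \<mu> :: "'a measure"
    and ip :: "'a operator \<Rightarrow> 'a operator \<Rightarrow> real"
    and Y :: "nat \<Rightarrow> 'a operator"
    and R :: "('a \<Rightarrow> complex mat) set"
    and \<nu> :: "('a \<Rightarrow> complex mat) \<Rightarrow> real"
  assumes haar: "haar_measure G \<mu>"
    and metric: "biinvariant_metric G n A ip"
    and basis: "orthonormal_basis G n A ip Y"
    and representatives: "dual_representatives G R"
    and eigenvalue_nonneg: "\<phi> \<in> R \<Longrightarrow> 0 \<le> \<nu> \<phi>"
    and entry_smooth: "\<phi> \<in> R \<Longrightarrow> i < rep_dim G \<phi> \<Longrightarrow> j < rep_dim G \<phi> \<Longrightarrow>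
          (\<lambda>x. \<phi> x $$ (i, j)) \<in> smooth_functions n A"
    and entry_eigenfunction: "\<phi> \<in> R \<Longrightarrow> i < rep_dim G \<phi> \<Longrightarrow> j < rep_dim G \<phi> \<Longrightarrow>
          - laplace_beltrami n ip Y (\<lambda>x. \<phi> x $$ (i, j)) x = of_real (\<nu> \<phi>) * \<phi> x $$ (i, j)"

definition japanese_bracket :: "(('a \<Rightarrow> complex mat) \<Rightarrow> real) \<Rightarrow> ('a \<Rightarrow> complex mat) \<Rightarrow> real" where
  "japanese_bracket \<nu> \<phi> = sqrt (1 + \<nu> \<phi>)"


section \<open>Weight sequences and ultradifferentiable functions\<close>

definition weight_sequence :: "(nat \<Rightarrow> real) \<Rightarrow> bool" where
  "weight_sequence M \<longleftrightarrow> (\<forall>k. 0 < M k) \<and>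
     (\<exists>H>0. \<exists>B\<ge>1.
        M 0 = 1 \<and>
        (\<forall>k. M (k + 1) \<le> B * H ^ k * M k) \<and>
        (\<forall>k. M (2 * k) \<le> B * H ^ (2 * k) * (M k)\<^sup>2)) \<and>
     (\<forall>l>0. \<exists>c>0. \<forall>k. fact k \<le> c * l ^ k * M k) \<and>
     (\<forall>r s. M r / fact r * (M s / fact s) \<le> M (r + s) / fact (r + s)) \<and>
     (\<forall>k\<ge>1. (M k)\<^sup>2 \<le> M (k - 1) * M (k + 1))"

definition associated_function :: "(nat \<Rightarrow> real) \<Rightarrow> real \<Rightarrow> real" where
  "associated_function M r = (if r = 0 then 0 else (SUP k. ln (r ^ k / M k)))"

text \<open>
  Multi-indices together with an order of composition are words \<open>w\<close> over the index set \<open>I\<close> of the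
  basis: the derivative is \<open>foldr Y w f\<close>, and \<open>|\<alpha>|\<close> is \<open>length w\<close>. The smooth functions \<open>S\<close>, the
  basis \<open>Y\<close> indexed by \<open>I\<close>, and the Haar measure \<open>\<mu>\<close> are parameters, so that the definitions apply
  to a group as well as to a product of two groups.
\<close>

definition l2_norm :: "'a measure \<Rightarrow> ('a \<Rightarrow> complex) \<Rightarrow> real" where
  "l2_norm \<mu> f = sqrt (LINT x|\<mu>. (cmod (f x))\<^sup>2)"

definition beurling_class ::
    "(nat \<Rightarrow> real) \<Rightarrow> ('a \<Rightarrow> complex) set \<Rightarrow> 'i set \<Rightarrow> ('i \<Rightarrow> 'a operator) \<Rightarrow> 'a measure
      \<Rightarrow> ('a \<Rightarrow> complex) set" where
  "beurling_class M S I Y \<mu> =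
     {f \<in> S. \<forall>h>0. \<exists>C>0. \<forall>w \<in> lists I. l2_norm \<mu> (foldr Y w f) \<le> C * h ^ length w * M (length w)}"

definition linear_on :: "('a \<Rightarrow> complex) set \<Rightarrow> (('a \<Rightarrow> complex) \<Rightarrow> complex) \<Rightarrow> bool" where
  "linear_on V u \<longleftrightarrow> (\<forall>f\<in>V. \<forall>g\<in>V. u (\<lambda>x. f x + g x) = u f + u g) \<and>
     (\<forall>f\<in>V. \<forall>c. u (\<lambda>x. c * f x) = c * u f)"

text \<open>
  The suprema below are taken in \<^typ>\<open>ennreal\<close>; on the Beurling class they are finite. The
  \<open>L\<^sup>\<infinity>\<close> norm of a (continuous) derivative is its supremum.
\<close>

definition ultradistributions ::
    "(nat \<Rightarrow> real) \<Rightarrow> ('a \<Rightarrow> complex) set \<Rightarrow> 'i set \<Rightarrow> ('i \<Rightarrow> 'a operator) \<Rightarrow> 'a measure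
      \<Rightarrow> (('a \<Rightarrow> complex) \<Rightarrow> complex) set" where
  "ultradistributions M S I Y \<mu> =
     {u. linear_on (beurling_class M S I Y \<mu>) u \<and>
         (\<exists>l>0. \<exists>C>0. \<forall>\<psi> \<in> beurling_class M S I Y \<mu>.
            ennreal (cmod (u \<psi>)) \<le>
              ennreal C * (SUP w \<in> lists I.
                ennreal (l ^ length w / M (length w)) * (SUP x. ennreal (cmod (foldr Y w \<psi> x)))))}"

definition ultra_norm ::
    "(nat \<Rightarrow> real) \<Rightarrow> 'i set \<Rightarrow> ('i \<Rightarrow> 'a operator) \<Rightarrow> real \<Rightarrow> ('a \<Rightarrow> complex) \<Rightarrow> ennreal" where
  "ultra_norm M I Y h \<phi> =
     (SUP w \<in> lists I. SUP x. ennreal (cmod (foldr Y w \<phi> x) / (h ^ length w * M (length w))))"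


section \<open>Products\<close>

text \<open>The vector fields of the two factors, acting on functions on the product.\<close>

fun prod_basis ::
    "(nat \<Rightarrow> 'a operator) \<Rightarrow> (nat \<Rightarrow> 'b operator) \<Rightarrow> nat + nat \<Rightarrow> ('a \<times> 'b) operator" where
  "prod_basis Y1 Y2 (Inl j) f = (\<lambda>(x1, x2). Y1 j (\<lambda>y. f (y, x2)) x1)"
| "prod_basis Y1 Y2 (Inr j) f = (\<lambda>(x1, x2). Y2 j (\<lambda>y. f (x1, y)) x2)"

definition tensor :: "('a \<Rightarrow> complex) \<Rightarrow> ('b \<Rightarrow> complex) \<Rightarrow> 'a \<times> 'b \<Rightarrow> complex" where
  "tensor \<phi> \<psi> = (\<lambda>(x1, x2). \<phi> x1 * \<psi> x2)"

definition conj_entry :: "('a \<Rightarrow> complex mat) \<Rightarrow> nat \<Rightarrow> nat \<Rightarrow> 'a \<Rightarrow> complex" where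
  "conj_entry \<phi> i j = (\<lambda>x. cnj (\<phi> x $$ (i, j)))"

definition partial_fourier_coeff ::
    "(('a \<times> 'b \<Rightarrow> complex) \<Rightarrow> complex) \<Rightarrow> ('b \<Rightarrow> complex mat) \<Rightarrow> nat \<Rightarrow> nat
      \<Rightarrow> ('a \<Rightarrow> complex) \<Rightarrow> complex" where
  "partial_fourier_coeff u \<eta> r s \<phi> = u (tensor \<phi> (conj_entry \<eta> s r))"

definition complex_span :: "('a \<Rightarrow> complex) set \<Rightarrow> ('a \<Rightarrow> complex) set" where
  "complex_span B = {\<lambda>x. \<Sum>i<k. c i * f i x | (k :: nat) c f. \<forall>i<k. f i \<in> B}"

definition group_beurling_class ::
    "(nat \<Rightarrow> real) \<Rightarrow> nat \<Rightarrow> 'a chart set \<Rightarrow> 'a measure \<Rightarrow> (nat \<Rightarrow> 'a operator)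
      \<Rightarrow> ('a \<Rightarrow> complex) set" where
  "group_beurling_class M n A \<mu> Y = beurling_class M (smooth_functions n A) {..<n} Y \<mu>"

definition group_ultradistributions ::
    "(nat \<Rightarrow> real) \<Rightarrow> nat \<Rightarrow> 'a chart set \<Rightarrow> 'a measure \<Rightarrow> (nat \<Rightarrow> 'a operator)
      \<Rightarrow> (('a \<Rightarrow> complex) \<Rightarrow> complex) set" where
  "group_ultradistributions M n A \<mu> Y = ultradistributions M (smooth_functions n A) {..<n} Y \<mu>"

text \<open>
  For the product group the smooth structure is the product one, the basis is the union of the two
  bases, and the normalised Haar measure is the product measure.
\<close>

definition prod_ultradistributions ::
    "(nat \<Rightarrow> real) \<Rightarrow> nat \<Rightarrow> 'a chart set \<Rightarrow> 'a measure \<Rightarrow> (nat \<Rightarrow> 'a operator)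
      \<Rightarrow> nat \<Rightarrow> 'b chart set \<Rightarrow> 'b measure \<Rightarrow> (nat \<Rightarrow> 'b operator)
      \<Rightarrow> (('a \<times> 'b \<Rightarrow> complex) \<Rightarrow> complex) set" where
  "prod_ultradistributions M n1 A1 \<mu>1 Y1 n2 A2 \<mu>2 Y2 =
     ultradistributions M (smooth_functions (n1 + n2) (prod_atlas n1 A1 A2))
       ({..<n1} <+> {..<n2}) (prod_basis Y1 Y2) (\<mu>1 \<Otimes>\<^sub>M \<mu>2)"

definition partial_fourier_span ::
    "('a \<Rightarrow> complex) set \<Rightarrow> 'b monoid \<Rightarrow> ('b \<Rightarrow> complex mat) set \<Rightarrow> ('a \<times> 'b \<Rightarrow> complex) set" where
  "partial_fourier_span \<Gamma> G2 R2 =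
     complex_span {tensor \<phi> (conj_entry \<eta> s r) | \<phi> \<eta> r s.
       \<phi> \<in> \<Gamma> \<and> \<eta> \<in> R2 \<and> r < rep_dim G2 \<eta> \<and> s < rep_dim G2 \<eta>}"


section \<open>Fourier coefficients of ultradistributions\<close>

definition determined_by_fourier_coeffs ::
    "('a \<Rightarrow> complex) set \<Rightarrow> (('a \<Rightarrow> complex) \<Rightarrow> complex) set \<Rightarrow> 'a monoid
      \<Rightarrow> ('a \<Rightarrow> complex mat) set \<Rightarrow> bool" where
  "determined_by_fourier_coeffs \<Gamma> \<Gamma>' G R \<longleftrightarrow>
     (\<forall>v\<in>\<Gamma>'. \<forall>v'\<in>\<Gamma>'.
        (\<forall>\<xi>\<in>R. \<forall>i < rep_dim G \<xi>. \<forall>j < rep_dim G \<xi>.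
           v (conj_entry \<xi> j i) = v' (conj_entry \<xi> j i)) \<longrightarrow>
        (\<forall>\<psi>\<in>\<Gamma>. v \<psi> = v' \<psi>))"

text \<open>
  On a product, indexed by the pairs in \<open>R1 \<times> R2\<close>: the dual of the product consists of the (classes
  of the) tensor products, whose entries are the products of the entries of the factors.
\<close>

definition prod_fourier_characterization ::
    "(nat \<Rightarrow> real) \<Rightarrow> (('a \<times> 'b \<Rightarrow> complex) \<Rightarrow> complex) set
      \<Rightarrow> 'a monoid \<Rightarrow> ('a \<Rightarrow> complex mat) set \<Rightarrow> (('a \<Rightarrow> complex mat) \<Rightarrow> real)
      \<Rightarrow> 'b monoid \<Rightarrow> ('b \<Rightarrow> complex mat) set \<Rightarrow> (('b \<Rightarrow> complex mat) \<Rightarrow> real) \<Rightarrow> bool" where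
  "prod_fourier_characterization M \<Gamma>' G1 R1 \<nu>1 G2 R2 \<nu>2 \<longleftrightarrow>
     (\<forall>a :: ('a \<Rightarrow> complex mat) \<Rightarrow> ('b \<Rightarrow> complex mat) \<Rightarrow> nat \<Rightarrow> nat \<Rightarrow> nat \<Rightarrow> nat \<Rightarrow> complex.
        (\<exists>v\<in>\<Gamma>'. \<forall>\<xi>\<in>R1. \<forall>\<eta>\<in>R2.
           \<forall>i < rep_dim G1 \<xi>. \<forall>j < rep_dim G1 \<xi>. \<forall>r < rep_dim G2 \<eta>. \<forall>s < rep_dim G2 \<eta>.
             v (tensor (conj_entry \<xi> j i) (conj_entry \<eta> s r)) = a \<xi> \<eta> i j r s) \<longleftrightarrow>
        (\<exists>N>0. \<exists>C>0. \<forall>\<xi>\<in>R1. \<forall>\<eta>\<in>R2.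
           \<forall>i < rep_dim G1 \<xi>. \<forall>j < rep_dim G1 \<xi>. \<forall>r < rep_dim G2 \<eta>. \<forall>s < rep_dim G2 \<eta>.
             cmod (a \<xi> \<eta> i j r s) \<le>
               C * exp (associated_function M
                 (N * (japanese_bracket \<nu>1 \<xi> + japanese_bracket \<nu>2 \<eta>)))))"

end

theory Submission
  imports Defs
begin

text \<open>
  A representative satisfies \<open>Y\<^sub>j \<eta> = \<eta> A\<^sub>j\<close> with skew-Hermitian matrices \<open>A\<^sub>j\<close>
  and \<open>\<Sum>\<^sub>j A\<^sub>j\<^sup>2 = -\<nu>\<close>. Hence \<open>\<Sum>\<^sub>j |A\<^sub>j v|\<^sup>2 = \<nu> |v|\<^sup>2\<close>, and every
  derivative of order \<open>k\<close> of an entry of \<open>\<eta>\<close> is bounded by \<open>\<langle>\<eta>\<rangle>\<^sup>k\<close>.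

  Since \<open>M\<^sub>r M\<^sub>s \<le> M\<^bsub>r+s\<^esub>\<close>, the seminorm with parameter \<open>l\<close> of \<open>\<phi>\<close> times a
  conjugate entry of \<open>\<eta>\<close> is at most the norm of \<open>\<phi>\<close> with \<open>h = 1/l\<close> times \<open>exp M(l\<langle>\<eta>\<rangle>)\<close>,
  which gives the estimate for an ultradistribution on the product. Conversely, the estimate applied
  to conjugate entries of representatives of \<open>G\<^sub>1\<close> bounds the Fourier coefficients, the product
  of the two exponentials being absorbed by (M.2). The characterization yields an
  ultradistribution \<open>v\<close> with these coefficients; for fixed \<open>\<eta>, r, s\<close> the partial coefficients of
  \<open>u\<close> and \<open>v\<close> are ultradistributions on \<open>G\<^sub>1\<close> with the same Fourier coefficients, so they agree.
\<close>

section \<open>Smooth functions\<close>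

text \<open>Openness along coordinate lines is all that iterated partial derivatives need.\<close>

definition line_open :: "nat \<Rightarrow> (nat \<Rightarrow> real) set \<Rightarrow> bool" where
  "line_open n V \<longleftrightarrow> (\<forall>x\<in>V. \<forall>i<n. eventually (\<lambda>t. x(i := t) \<in> V) (nhds (x i)))"

text \<open>Changing a coordinate \<open>i < n\<close> stays among the sequences that vanish from
  \<open>n\<close> on and is continuous for the product topology, so relative openness passes to
  coordinate lines.\<close>

lemma line_open_if_openin:
  assumes "openin (Euclidean_space n) V"
  shows "line_open n V"
  unfolding line_open_def
proof (intro ballI allI impI)
  fix x i assume x: "x \<in> V" and i: "i < n"
  obtain U where U: "open U" "V = U \<inter> {x. \<forall>i\<ge>n. x i = 0}"
    using assms unfolding Euclidean_space_def openin_subtopology euclidean_product_topology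
      open_openin[symmetric] by blast
  have "continuous_on UNIV (\<lambda>t. x(i := t))"
  proof (rule continuous_on_coordinatewise_then_product)
    show "continuous_on UNIV (\<lambda>t. (x(i := t)) j)" for j by (cases "j = i") auto
  qed
  then have "isCont (\<lambda>t. x(i := t)) (x i)"
    by (simp add: continuous_on_eq_continuous_at)
  then have "((\<lambda>t. x(i := t)) \<longlongrightarrow> x(i := x i)) (nhds (x i))"
    unfolding isCont_def by (subst (asm) tendsto_at_iff_tendsto_nhds)
  then have "eventually (\<lambda>t. x(i := t) \<in> U) (nhds (x i))"
    using U x by (intro topological_tendstoD) auto
  then show "eventually (\<lambda>t. x(i := t) \<in> V) (nhds (x i))"
    by (rule eventually_mono) (use U x i in auto)
qed

section \<open>Iterated partial derivatives on a line-open set\<close>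

lemma smooth_on_coord_imp_continuous: "smooth_on_coord n V f \<Longrightarrow> continuous_on V f"
  unfolding smooth_on_coord_def by (drule bspec[of _ _ "[]"]) auto

lemma smooth_on_coord_partial_deriv:
  assumes "smooth_on_coord n V f" "i < n"
  shows "smooth_on_coord n V (partial_deriv i f)"
  unfolding smooth_on_coord_def
proof
  fix w assume "w \<in> lists {..<n}"
  then have "w @ [i] \<in> lists {..<n}" using assms by auto
  then show "continuous_on V (foldr partial_deriv w (partial_deriv i f)) \<and>
        (\<forall>x\<in>V. \<forall>j<n. (\<lambda>t. foldr partial_deriv w (partial_deriv i f) (x(j := t))) differentiable (at (x j)))"
    using assms(1) unfolding smooth_on_coord_def by (drule_tac bspec[of _ _ "w @ [i]"]) auto
qed

lemma smooth_on_coord_has_partial_deriv: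
  assumes "smooth_on_coord n V f" "i < n" "x \<in> V"
  shows "((\<lambda>t. f (x(i := t))) has_vector_derivative partial_deriv i f x) (at (x i))"
proof -
  have "(\<lambda>t. f (x(i := t))) differentiable (at (x i))"
    using assms unfolding smooth_on_coord_def by (drule_tac bspec[of _ _ "[]"]) auto
  then show ?thesis
    unfolding partial_deriv_def by (simp add: vector_derivative_works)
qed

text \<open>
  Membership in a class of functions that is closed under partial derivatives on \<open>V\<close> suffices
  for smoothness; the class need not consist of genuine iterates of \<^const>\<open>partial_deriv\<close>.
\<close>

lemma smooth_on_coord_coinduct:
  assumes V: "line_open n V" and f: "f\<^sub>0 \<in> \<C>" and eq: "\<And>x. x \<in> V \<Longrightarrow> f x = f\<^sub>0 x"
    and cont: "\<And>g. g \<in> \<C> \<Longrightarrow> continuous_on V g"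
    and deriv: "\<And>g i. g \<in> \<C> \<Longrightarrow> i < n \<Longrightarrow>
      \<exists>g'\<in>\<C>. \<forall>x\<in>V. ((\<lambda>t. g (x(i := t))) has_vector_derivative g' x) (at (x i))"
  shows "smooth_on_coord n V f"
proof -
  \<comment> \<open>Near \<open>x i\<close> the coordinate line stays in \<open>V\<close>, so
    functions that agree on \<open>V\<close> have the same derivative there, whatever their values
    elsewhere.\<close>
  have transfer: "((\<lambda>t. h (x(i := t))) has_vector_derivative D) (at (x i))"
    if "\<forall>y\<in>V. h y = g y" "x \<in> V" "i < n"
      "((\<lambda>t. g (x(i := t))) has_vector_derivative D) (at (x i))" for h g :: "(nat \<Rightarrow> real) \<Rightarrow> 'a" and x i D
  proof -
    have "eventually (\<lambda>t. x(i := t) \<in> V) (nhds (x i))"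
      using V that unfolding line_open_def by blast
    then have "eventually (\<lambda>t. g (x(i := t)) = h (x(i := t))) (at (x i))"
      unfolding eventually_at_filter by (rule eventually_mono) (use that(1) in simp)
    then show ?thesis
      using that(1,2) unfolding has_vector_derivative_def
      by (intro has_derivative_transform_eventually[OF that(4)[unfolded has_vector_derivative_def]])
        simp_all
  qed
  have *: "\<exists>g\<in>\<C>. \<forall>x\<in>V. foldr partial_deriv w f x = g x" if "w \<in> lists {..<n}" for w
    using that
  proof (induction w)
    case Nil
    then show ?case using f eq by auto
  next
    case (Cons i w)
    then have i: "i < n" by simp
    from Cons.IH obtain g where g: "g \<in> \<C>" "\<forall>x\<in>V. foldr partial_deriv w f x = g x"
      by blast
    obtain g' where g': "g' \<in> \<C>"
      "\<And>x. x \<in> V \<Longrightarrow> ((\<lambda>t. g (x(i := t))) has_vector_derivative g' x) (at (x i))"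
      using deriv[OF g(1) i] by auto
    have "foldr partial_deriv (i # w) f x = g' x" if "x \<in> V" for x
      using transfer[OF g(2) that i g'(2)[OF that]]
      by (simp add: partial_deriv_def vector_derivative_at)
    then show ?case using g' by auto
  qed
  show ?thesis
    unfolding smooth_on_coord_def
  proof (intro ballI conjI allI impI)
    fix w assume w: "w \<in> lists {..<n}"
    then obtain g where g: "g \<in> \<C>" "\<forall>x\<in>V. foldr partial_deriv w f x = g x"
      using * by blast
    show "continuous_on V (foldr partial_deriv w f)"
      using cont[OF g(1)] g(2) by (simp cong: continuous_on_cong)
    fix x i assume x: "x \<in> V" and i: "i < n"
    obtain g' where g': "((\<lambda>t. g (x(i := t))) has_vector_derivative g' x) (at (x i))"
      using deriv[OF g(1) i] x by auto
    show "(\<lambda>t. foldr partial_deriv w f (x(i := t))) differentiable (at (x i))"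
      using transfer[OF g(2) x i g'] by (rule differentiableI_vector)
  qed
qed

text \<open>The iterates of \<open>partial_deriv\<close> are total functions that may differ off
  \<open>V\<close>, so equality on \<open>V\<close> has to be carried through all of them. The class
  of all functions smooth on \<open>V\<close> is closed under derivatives and does this.\<close>

lemma smooth_on_coord_cong:
  assumes "line_open n V" "smooth_on_coord n V f" "\<And>x. x \<in> V \<Longrightarrow> f x = g x"
  shows "smooth_on_coord n V g"
proof (rule smooth_on_coord_coinduct[where \<C> = "Collect (smooth_on_coord n V)" and f\<^sub>0 = f])
  show "\<exists>h'\<in>Collect (smooth_on_coord n V).
      \<forall>x\<in>V. ((\<lambda>t. h (x(i := t))) has_vector_derivative h' x) (at (x i))"
    if "h \<in> Collect (smooth_on_coord n V)" "i < n" for h i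
    by (intro bexI[of _ "partial_deriv i h"] ballI CollectI
        smooth_on_coord_has_partial_deriv smooth_on_coord_partial_deriv) (use that in blast)+
qed (use assms smooth_on_coord_imp_continuous in \<open>force+\<close>)

text \<open>One closure for sums, products and conjugates: the product rule expresses a derivative
  through members of the same set, so induction on membership produces the derivative that the
  coinduction principle asks for, without a Leibniz formula for words. The rule \<open>const\<close>
  also supplies the zero derivative.\<close>

inductive_set smooth_algebra :: "nat \<Rightarrow> (nat \<Rightarrow> real) set \<Rightarrow> ((nat \<Rightarrow> real) \<Rightarrow> complex) set"
  for n V where
  base: "smooth_on_coord n V f \<Longrightarrow> f \<in> smooth_algebra n V"
| const: "(\<lambda>x. c) \<in> smooth_algebra n V"
| add: "f \<in> smooth_algebra n V \<Longrightarrow> g \<in> smooth_algebra n V \<Longrightarrow> (\<lambda>x. f x + g x) \<in> smooth_algebra n V"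
| mult: "f \<in> smooth_algebra n V \<Longrightarrow> g \<in> smooth_algebra n V \<Longrightarrow> (\<lambda>x. f x * g x) \<in> smooth_algebra n V"
| cnj: "f \<in> smooth_algebra n V \<Longrightarrow> (\<lambda>x. cnj (f x)) \<in> smooth_algebra n V"

lemma smooth_algebra_imp_smooth:
  assumes "line_open n V" "f \<in> smooth_algebra n V"
  shows "smooth_on_coord n V f"
proof (rule smooth_on_coord_coinduct[where \<C> = "smooth_algebra n V" and f\<^sub>0 = f])
  fix g assume "g \<in> smooth_algebra n V"
  then show "continuous_on V g"
    by induction (auto intro!: continuous_intros intro: smooth_on_coord_imp_continuous)
next
  fix g :: "(nat \<Rightarrow> real) \<Rightarrow> complex" and i assume "g \<in> smooth_algebra n V" and i: "i < n"
  then show "\<exists>g'\<in>smooth_algebra n V. \<forall>x\<in>V. ((\<lambda>t. g (x(i := t))) has_vector_derivative g' x) (at (x i))"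
  proof induction
    case (base f)
    then show ?case
      by (intro bexI[of _ "partial_deriv i f"] smooth_algebra.base ballI
          smooth_on_coord_has_partial_deriv[OF base(1) i] smooth_on_coord_partial_deriv[OF base(1) i])
  next
    case (const c)
    show ?case by (intro bexI[of _ "\<lambda>_. 0"] smooth_algebra.const) auto
  next
    case (add f g)
    then obtain f' g' where "f' \<in> smooth_algebra n V" "g' \<in> smooth_algebra n V"
      "\<forall>x\<in>V. ((\<lambda>t. f (x(i := t))) has_vector_derivative f' x) (at (x i))"
      "\<forall>x\<in>V. ((\<lambda>t. g (x(i := t))) has_vector_derivative g' x) (at (x i))" by blast
    then show ?case
      by (intro bexI[of _ "\<lambda>x. f' x + g' x"] smooth_algebra.add ballI has_vector_derivative_add)
        blast+
  next
    case (mult f g)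
    then obtain f' g' where *: "f' \<in> smooth_algebra n V" "g' \<in> smooth_algebra n V"
      "\<forall>x\<in>V. ((\<lambda>t. f (x(i := t))) has_vector_derivative f' x) (at (x i))"
      "\<forall>x\<in>V. ((\<lambda>t. g (x(i := t))) has_vector_derivative g' x) (at (x i))" by blast
    have "((\<lambda>t. f (x(i := t)) * g (x(i := t))) has_vector_derivative
        (f x * g' x + f' x * g x)) (at (x i))" if "x \<in> V" for x
      using has_vector_derivative_mult[OF bspec[OF *(3) that] bspec[OF *(4) that]]
      by (simp only: fun_upd_triv)
    then show ?case
      using *(1,2) mult.hyps
      by (intro bexI[of _ "\<lambda>x. f x * g' x + f' x * g x"] smooth_algebra.intros(3,4) ballI)
  next
    case (cnj f)
    then obtain f' where "f' \<in> smooth_algebra n V"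
      "\<forall>x\<in>V. ((\<lambda>t. f (x(i := t))) has_vector_derivative f' x) (at (x i))" by blast
    then show ?case
      by (intro bexI[of _ "\<lambda>x. cnj (f' x)"] smooth_algebra.cnj ballI
          bounded_linear.has_vector_derivative[OF bounded_linear_cnj]) blast+
  qed
qed (use assms in auto)

section \<open>Charts and smooth functions on the manifold\<close>

lemma is_chart_line_open:
  assumes "is_chart n (U, \<kappa>)"
  shows "line_open n (\<kappa> ` U)"
  using assms by (auto simp: is_chart_def intro: line_open_if_openin)

lemma is_chart_inj: "is_chart n (U, \<kappa>) \<Longrightarrow> inj_on \<kappa> U"
  unfolding is_chart_def using homeomorphic_imp_injective_map by fastforce

lemma is_chart_continuous_on: "is_chart n (U, \<kappa>) \<Longrightarrow> continuous_on U \<kappa>"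
  unfolding is_chart_def Euclidean_space_def
  by (auto dest!: homeomorphic_imp_continuous_map
      simp: continuous_map_in_subtopology euclidean_product_topology subtopology_subtopology)

text \<open>Lets padding with zeros recover the chart of the first factor from a product
  chart.\<close>

lemma is_chart_zero:
  assumes "is_chart n (U, \<kappa>)" "x \<in> U" "i \<ge> n"
  shows "\<kappa> x i = 0"
  using assms openin_subset[of "Euclidean_space n" "\<kappa> ` U"]
  by (auto simp: is_chart_def topspace_Euclidean_space)

lemma smooth_atlas_is_chart: "smooth_atlas n A \<Longrightarrow> (U, \<kappa>) \<in> A \<Longrightarrow> is_chart n (U, \<kappa>)"
  by (auto simp: smooth_atlas_def)

lemma smooth_functions_closed:
  assumes A: "smooth_atlas n A"
  shows smooth_functions_const: "(\<lambda>x. c) \<in> smooth_functions n A"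
    and smooth_functions_add: "f \<in> smooth_functions n A \<Longrightarrow> g \<in> smooth_functions n A \<Longrightarrow>
      (\<lambda>x. f x + g x) \<in> smooth_functions n A"
    and smooth_functions_mult: "f \<in> smooth_functions n A \<Longrightarrow> g \<in> smooth_functions n A \<Longrightarrow>
      (\<lambda>x. f x * g x) \<in> smooth_functions n A"
    and smooth_functions_cnj: "f \<in> smooth_functions n A \<Longrightarrow> (\<lambda>x. cnj (f x)) \<in> smooth_functions n A"
proof -
  note algebra = smooth_algebra_imp_smooth[OF is_chart_line_open[OF smooth_atlas_is_chart[OF A]]]
  have base: "(\<lambda>y. f (inv_into U \<kappa> y)) \<in> smooth_algebra n (\<kappa> ` U)"
    if "f \<in> smooth_functions n A" "(U, \<kappa>) \<in> A" for f U \<kappa>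
    using that by (auto simp: smooth_functions_def intro: smooth_algebra.base)
  show "(\<lambda>x. c) \<in> smooth_functions n A"
    unfolding smooth_functions_def by (auto intro!: algebra smooth_algebra.const)
  show "(\<lambda>x. cnj (f x)) \<in> smooth_functions n A" if "f \<in> smooth_functions n A"
    unfolding smooth_functions_def
    using base[OF that] by (auto intro!: algebra dest: smooth_algebra.cnj)
  assume "f \<in> smooth_functions n A" "g \<in> smooth_functions n A"
  note base = base[OF this(1)] base[OF this(2)]
  show "(\<lambda>x. f x + g x) \<in> smooth_functions n A"
    unfolding smooth_functions_def using smooth_algebra.add[OF base] by (auto intro!: algebra)
  show "(\<lambda>x. f x * g x) \<in> smooth_functions n A"
    unfolding smooth_functions_def using smooth_algebra.mult[OF base] by (auto intro!: algebra)
qed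

lemma smooth_functions_scale:
  assumes "smooth_atlas n A" "f \<in> smooth_functions n A"
  shows "(\<lambda>x. c * f x) \<in> smooth_functions n A"
  by (intro smooth_functions_mult smooth_functions_const assms)

lemma smooth_functions_sum:
  assumes "smooth_atlas n A" "\<And>i. i \<in> I \<Longrightarrow> f i \<in> smooth_functions n A"
  shows "(\<lambda>x. \<Sum>i\<in>I. f i x) \<in> smooth_functions n A"
  using assms(2)
  by (induction I rule: infinite_finite_induct)
    (auto intro: smooth_functions_const smooth_functions_add assms(1))

text \<open>On a chart domain, \<open>f\<close> is its coordinate expression composed with the
  chart; the domains are open and cover the manifold.\<close>

lemma smooth_functions_continuous:
  assumes A: "smooth_atlas n A" and f: "f \<in> smooth_functions n A"
  shows "continuous_on UNIV f"
proof -
  have "continuous_on U f" if U: "(U, \<kappa>) \<in> A" for U \<kappa>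
  proof -
    note chart = smooth_atlas_is_chart[OF A U]
    have "continuous_on (\<kappa> ` U) (\<lambda>y. f (inv_into U \<kappa> y))"
      using f U by (auto simp: smooth_functions_def intro: smooth_on_coord_imp_continuous)
    then have "continuous_on U (\<lambda>x. f (inv_into U \<kappa> (\<kappa> x)))"
      by (rule continuous_on_compose2[OF _ is_chart_continuous_on[OF chart]]) auto
    then show ?thesis
      using is_chart_inj[OF chart] by (simp cong: continuous_on_cong)
  qed
  then have "continuous_on (\<Union>(fst ` A)) f"
    using smooth_atlas_is_chart[OF A]
    by (intro continuous_on_open_Union) (auto simp: is_chart_def)
  then show ?thesis using A by (simp add: smooth_atlas_def)
qed

text \<open>Finite sums of tensors contain the whole Fourier span, and on them the product vector
  fields can be computed factor by factor. A scalar is absorbed into one of the factors.\<close>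

inductive_set tensor_sums :: "('a \<Rightarrow> complex) set \<Rightarrow> ('b \<Rightarrow> complex) set \<Rightarrow> ('a \<times> 'b \<Rightarrow> complex) set"
  for S1 S2 where
  tensor: "\<phi> \<in> S1 \<Longrightarrow> \<psi> \<in> S2 \<Longrightarrow> tensor \<phi> \<psi> \<in> tensor_sums S1 S2"
| add: "f \<in> tensor_sums S1 S2 \<Longrightarrow> g \<in> tensor_sums S1 S2 \<Longrightarrow> (\<lambda>x. f x + g x) \<in> tensor_sums S1 S2"

text \<open>Padding with zeros keeps the first \<open>n\<close> coordinates in the model space of
  the first factor. The counterpart \<open>right_coords\<close> shifts by \<open>n\<close>, so that
  a sequence vanishing from \<open>n + m\<close> on is sent to one vanishing from \<open>m\<close>
  on.\<close>

definition left_coords :: "nat \<Rightarrow> (nat \<Rightarrow> real) \<Rightarrow> nat \<Rightarrow> real" where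
  "left_coords n z = (\<lambda>i. if i < n then z i else 0)"

definition right_coords :: "nat \<Rightarrow> (nat \<Rightarrow> real) \<Rightarrow> nat \<Rightarrow> real" where
  "right_coords n z = (\<lambda>i. z (i + n))"

section \<open>Smoothness of tensors in product charts\<close>

lemma left_coords_upd:
  "left_coords n (z(i := t)) = (if i < n then (left_coords n z)(i := t) else left_coords n z)"
  by (auto simp: left_coords_def)

lemma right_coords_upd:
  "right_coords n (z(i := t)) = (if i < n then right_coords n z else (right_coords n z)(i - n := t))"
  by (auto simp: right_coords_def fun_eq_iff)

text \<open>A partial derivative hits exactly one of the two factors, so the products of a smooth
  function of the left coordinates and one of the right coordinates form a class closed under
  partial derivatives.\<close>

lemma smooth_on_coord_tensor:
  fixes f g :: "(nat \<Rightarrow> real) \<Rightarrow> complex"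
  assumes V: "line_open (n + m) V"
    and sub: "left_coords n ` V \<subseteq> V1" "right_coords n ` V \<subseteq> V2"
    and f: "smooth_on_coord n V1 f" and g: "smooth_on_coord m V2 g"
  shows "smooth_on_coord (n + m) V (\<lambda>z. f (left_coords n z) * g (right_coords n z))"
proof (rule smooth_on_coord_coinduct[OF V, where \<C> =
    "{\<lambda>z. f (left_coords n z) * g (right_coords n z) | f g. smooth_on_coord n V1 f \<and> smooth_on_coord m V2 g}"
    and f\<^sub>0 = "\<lambda>z. f (left_coords n z) * g (right_coords n z)"])
  fix h assume "h \<in> {\<lambda>z. f (left_coords n z) * g (right_coords n z) | f g :: (nat \<Rightarrow> real) \<Rightarrow> complex.
    smooth_on_coord n V1 f \<and> smooth_on_coord m V2 g}"
  then obtain f g :: "(nat \<Rightarrow> real) \<Rightarrow> complex" where h: "h = (\<lambda>z. f (left_coords n z) * g (right_coords n z))"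
    and f: "smooth_on_coord n V1 f" and g: "smooth_on_coord m V2 g" by blast
  have "continuous_on V (\<lambda>z. z i)" for i
    by (rule continuous_on_product_then_coordinatewise) simp
  moreover from this have "continuous_on V (\<lambda>z. if i < n then z i else 0)" for i
    by (cases "i < n") auto
  ultimately have "continuous_on V (left_coords n)" "continuous_on V (right_coords n)"
    unfolding left_coords_def right_coords_def
    by (auto intro!: continuous_on_coordinatewise_then_product)
  then have "continuous_on V (\<lambda>z. f (left_coords n z))" "continuous_on V (\<lambda>z. g (right_coords n z))"
    using continuous_on_compose2[OF smooth_on_coord_imp_continuous[OF f]] sub
      continuous_on_compose2[OF smooth_on_coord_imp_continuous[OF g]] by auto
  then show "continuous_on V h" unfolding h by (intro continuous_intros)
  fix i assume i: "i < n + m"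
  show "\<exists>h'\<in>{\<lambda>z. f (left_coords n z) * g (right_coords n z) | f g.
      smooth_on_coord n V1 f \<and> smooth_on_coord m V2 g}.
      \<forall>x\<in>V. ((\<lambda>t. h (x(i := t))) has_vector_derivative h' x) (at (x i))"
  proof (cases "i < n")
    case True
    have "((\<lambda>t. h (x(i := t))) has_vector_derivative
        partial_deriv i f (left_coords n x) * g (right_coords n x)) (at (x i))" if "x \<in> V" for x
    proof -
      have "left_coords n x \<in> V1" "left_coords n x i = x i"
        using sub that True by (auto simp: left_coords_def)
      then show ?thesis
        using has_vector_derivative_mult_left[OF smooth_on_coord_has_partial_deriv[OF f True]]
        by (simp only: h left_coords_upd right_coords_upd True if_True) metis
    qed
    then show ?thesis
      using smooth_on_coord_partial_deriv[OF f True] g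
      by (intro bexI[of _ "\<lambda>x. partial_deriv i f (left_coords n x) * g (right_coords n x)"])
        (simp_all only: mem_Collect_eq, blast+)
  next
    case False
    then have i': "i - n < m" using i by auto
    have "((\<lambda>t. h (x(i := t))) has_vector_derivative
        f (left_coords n x) * partial_deriv (i - n) g (right_coords n x)) (at (x i))" if "x \<in> V" for x
    proof -
      have "right_coords n x \<in> V2" "right_coords n x (i - n) = x i"
        using sub that False by (auto simp: right_coords_def)
      then show ?thesis
        using has_vector_derivative_mult_right[OF smooth_on_coord_has_partial_deriv[OF g i']]
        by (simp only: h left_coords_upd right_coords_upd False if_False) metis
    qed
    then show ?thesis
      using smooth_on_coord_partial_deriv[OF g i'] f
      by (intro bexI[of _ "\<lambda>x. f (left_coords n x) * partial_deriv (i - n) g (right_coords n x)"])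
        (simp_all only: mem_Collect_eq, blast+)
  qed
qed (use f g in auto)

text \<open>Both factor charts are recovered by the coordinate projections, so injectivity and
  membership in the image are checked factor by factor. A coordinate line moves only one factor,
  which reduces line openness to that factor.\<close>

lemma prod_chart:
  fixes \<kappa> :: "'a::topological_space \<Rightarrow> nat \<Rightarrow> real" and \<tau> :: "'b::topological_space \<Rightarrow> nat \<Rightarrow> real"
  assumes c1: "is_chart n (U, \<kappa>)" and c2: "is_chart m (V, \<tau>)"
  defines "\<sigma> \<equiv> \<lambda>(x, y) i. if i < n then \<kappa> x i else \<tau> y (i - n)"
  shows prod_chart_left: "z \<in> U \<times> V \<Longrightarrow> left_coords n (\<sigma> z) = \<kappa> (fst z)"
    and prod_chart_right: "z \<in> U \<times> V \<Longrightarrow> right_coords n (\<sigma> z) = \<tau> (snd z)"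
    and prod_chart_inv: "z \<in> U \<times> V \<Longrightarrow> inv_into (U \<times> V) \<sigma> (\<sigma> z) = z"
    and prod_chart_line_open: "line_open (n + m) (\<sigma> ` (U \<times> V))"
proof -
  show l: "left_coords n (\<sigma> z) = \<kappa> (fst z)" if "z \<in> U \<times> V" for z
    using is_chart_zero[OF c1] that by (auto simp: left_coords_def \<sigma>_def fun_eq_iff split_beta)
  show r: "right_coords n (\<sigma> z) = \<tau> (snd z)" for z
    by (auto simp: right_coords_def \<sigma>_def fun_eq_iff split_beta)
  have "inj_on \<sigma> (U \<times> V)"
  proof (rule inj_onI)
    fix z z' assume z: "z \<in> U \<times> V" "z' \<in> U \<times> V" "\<sigma> z = \<sigma> z'"
    then have "\<kappa> (fst z) = \<kappa> (fst z')" "\<tau> (snd z) = \<tau> (snd z')"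
      by (metis l, metis r)
    then have "fst z = fst z'" "snd z = snd z'"
      using z(1,2) by (auto dest: inj_onD[OF is_chart_inj[OF c1]] inj_onD[OF is_chart_inj[OF c2]])
    then show "z = z'" by (rule prod_eqI)
  qed
  then show "inv_into (U \<times> V) \<sigma> (\<sigma> z) = z" if "z \<in> U \<times> V" for z using that by simp
  have image: "y \<in> \<sigma> ` (U \<times> V)"
    if left: "left_coords n y \<in> \<kappa> ` U" and right: "right_coords n y \<in> \<tau> ` V" for y
  proof -
    obtain u v where uv: "u \<in> U" "v \<in> V" "left_coords n y = \<kappa> u" "right_coords n y = \<tau> v"
      using left right by auto
    have "y = \<sigma> (u, v)"
    proof
      show "y i = \<sigma> (u, v) i" for i
        using fun_cong[OF uv(3), of i] fun_cong[OF uv(4), of "i - n"]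
        by (auto simp: \<sigma>_def left_coords_def right_coords_def split: if_splits)
    qed
    then show ?thesis using uv by auto
  qed
  show "line_open (n + m) (\<sigma> ` (U \<times> V))"
    unfolding line_open_def
  proof (intro ballI allI impI)
    fix y i assume y: "y \<in> \<sigma> ` (U \<times> V)" and i: "i < n + m"
    from y obtain z where z: "z \<in> U \<times> V" "y = \<sigma> z" by auto
    have yl: "left_coords n y \<in> \<kappa> ` U" and yr: "right_coords n y \<in> \<tau> ` V"
      using z l r by auto
    show "eventually (\<lambda>t. y(i := t) \<in> \<sigma> ` (U \<times> V)) (nhds (y i))"
    proof (cases "i < n")
      case True
      have "eventually (\<lambda>t. (left_coords n y)(i := t) \<in> \<kappa> ` U) (nhds (left_coords n y i))"
        using is_chart_line_open[OF c1] yl True unfolding line_open_def by blast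
      then have "eventually (\<lambda>t. (left_coords n y)(i := t) \<in> \<kappa> ` U) (nhds (y i))"
        using True by (simp add: left_coords_def)
      then show ?thesis
        by (rule eventually_mono) (rule image, use True yr in \<open>auto simp: left_coords_upd right_coords_upd\<close>)
    next
      case False
      have "eventually (\<lambda>t. (right_coords n y)(i - n := t) \<in> \<tau> ` V) (nhds (right_coords n y (i - n)))"
        using is_chart_line_open[OF c2] yr False i unfolding line_open_def
        by (metis add.commute less_diff_conv2 not_less)
      then have "eventually (\<lambda>t. (right_coords n y)(i - n := t) \<in> \<tau> ` V) (nhds (y i))"
        using False by (simp add: right_coords_def)
      then show ?thesis
        by (rule eventually_mono) (rule image, use False yl in \<open>auto simp: left_coords_upd right_coords_upd\<close>)
    qed
  qed
qed

lemma tensor_sums_subset_smooth: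
  assumes A1: "smooth_atlas n A1" and A2: "smooth_atlas m A2"
  shows "tensor_sums (smooth_functions n A1) (smooth_functions m A2) \<subseteq> smooth_functions (n + m) (prod_atlas n A1 A2)"
proof
  fix F assume F: "F \<in> tensor_sums (smooth_functions n A1) (smooth_functions m A2)"
  have "smooth_on_coord (n + m) (\<sigma> ` (U \<times> V)) (\<lambda>z. F (inv_into (U \<times> V) \<sigma> z))"
    if U: "(U, \<kappa>) \<in> A1" and V: "(V, \<tau>) \<in> A2" and \<sigma>: "\<sigma> = (\<lambda>(x, y) i. if i < n then \<kappa> x i else \<tau> y (i - n))"
    for U \<kappa> V \<tau> \<sigma>
  proof -
    note c = smooth_atlas_is_chart[OF A1 U] smooth_atlas_is_chart[OF A2 V]
    note P = prod_chart[OF c, folded \<sigma>]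
    from F show ?thesis
    proof induction
      case (tensor \<phi> \<psi>)
      let ?f = "\<lambda>y. \<phi> (inv_into U \<kappa> y)" and ?g = "\<lambda>y. \<psi> (inv_into V \<tau> y)"
      have fg: "smooth_on_coord n (\<kappa> ` U) ?f" "smooth_on_coord m (\<tau> ` V) ?g"
        using tensor U V by (auto simp: smooth_functions_def)
      have "smooth_on_coord (n + m) (\<sigma> ` (U \<times> V)) (\<lambda>z. ?f (left_coords n z) * ?g (right_coords n z))"
        by (rule smooth_on_coord_tensor[OF P(4) _ _ fg]) (use P in auto)
      \<comment> \<open>This holds only on the image of the chart, since \<open>inv_into\<close> is
        arbitrary elsewhere; hence the appeal to congruence on a line-open set.\<close>
      moreover have "?f (left_coords n z) * ?g (right_coords n z) = tensor \<phi> \<psi> (inv_into (U \<times> V) \<sigma> z)"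
        if "z \<in> \<sigma> ` (U \<times> V)" for z
        using that P(1-3) is_chart_inj[OF c(1)] is_chart_inj[OF c(2)] by (auto simp: tensor_def)
      ultimately show ?case
        by (rule smooth_on_coord_cong[OF P(4)])
    next
      case (add f g)
      show ?case
        by (rule smooth_algebra_imp_smooth[OF P(4)]) (intro smooth_algebra.intros(1,3) add.IH)
    qed
  qed
  then show "F \<in> smooth_functions (n + m) (prod_atlas n A1 A2)"
    by (auto simp: smooth_functions_def prod_atlas_def)
qed


section \<open>Weight sequences\<close>

lemma weight_sequence_pos: "weight_sequence M \<Longrightarrow> 0 < M k"
  by (simp add: weight_sequence_def)

text \<open>(M.4) gives the bound with an additional factor \<open>r! s! / (r + s)!\<close>, which
  is at most 1. It serves to split an order of differentiation between two factors.\<close>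

lemma weight_sequence_mult_le:
  assumes "weight_sequence M"
  shows "M r * M s \<le> M (r + s)"
proof -
  have "M r / fact r * (M s / fact s) \<le> M (r + s) / fact (r + s)"
    using assms by (simp add: weight_sequence_def)
  then have *: "M r * M s \<le> M (r + s) * ((fact r * fact s) / fact (r + s))"
    by (simp add: field_simps)
  have "fact r * fact s \<le> (fact (r + s) :: nat)"
    by (rule dvd_imp_le[OF fact_fact_dvd_fact]) simp
  then have "fact r * fact s \<le> (fact (r + s) :: real)"
    by (metis of_nat_fact of_nat_le_iff of_nat_mult)
  then have "M (r + s) * ((fact r * fact s) / fact (r + s)) \<le> M (r + s) * 1"
    using weight_sequence_pos[OF assms, of "r + s"] by (intro mult_left_mono) auto
  with * show ?thesis by simp
qed

text \<open>By (M.3'), geometric growth is dominated by \<open>h ^ k * M k\<close> however small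
  \<open>h\<close> is. This puts functions with geometrically growing derivatives, such as matrix
  entries, into the Beurling class.\<close>

lemma weight_sequence_power_le:
  assumes "weight_sequence M" "0 \<le> L" "0 < h"
  obtains C where "0 < C" "\<And>k. L ^ k \<le> C * h ^ k * M k"
proof -
  have "\<forall>l>0. \<exists>c>0. \<forall>k. fact k \<le> c * l ^ k * M k"
    using assms(1) unfolding weight_sequence_def by (elim conjE)
  \<comment> \<open>(M.3') is applied with \<open>h / (L + 1)\<close>, where the added 1 covers
    \<open>L = 0\<close>; of the factorial only \<open>1 \<le> fact k\<close> is kept.\<close>
  moreover have "0 < h / (L + 1)" using assms by simp
  ultimately obtain c where c: "0 < c" "\<And>k. fact k \<le> c * (h / (L + 1)) ^ k * M k"
    by blast
  have "L ^ k \<le> c * h ^ k * M k" for k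
  proof -
    have "1 \<le> c * (h / (L + 1)) ^ k * M k"
      using c(2)[of k] fact_ge_1[of k, where 'a = real] by linarith
    then have "(L + 1) ^ k \<le> c * h ^ k * M k"
      using assms by (simp add: power_divide field_simps)
    moreover have "L ^ k \<le> (L + 1) ^ k" using assms by (intro power_mono) auto
    ultimately show ?thesis by linarith
  qed
  with c(1) that show thesis by blast
qed

text \<open>A real supremum bounds its terms only if they are bounded above; the previous bound with
  \<open>h = 1\<close> shows that \<open>ln C\<close> is an upper bound.\<close>

lemma power_div_le_exp_associated_function:
  assumes M: "weight_sequence M" and r: "0 < r"
  shows "r ^ k / M k \<le> exp (associated_function M r)"
proof -
  note pos = weight_sequence_pos[OF M]
  obtain C where C: "0 < C" "\<And>k. r ^ k \<le> C * 1 ^ k * M k"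
    using weight_sequence_power_le[OF M, of r 1] r by auto
  have "ln (r ^ k / M k) \<le> ln C" for k
    using C(2)[of k] C(1) pos[of k] r by (subst ln_le_cancel_iff) (auto simp: field_simps)
  then have "bdd_above (range (\<lambda>k. ln (r ^ k / M k)))"
    by (intro bdd_aboveI[of _ "ln C"]) auto
  then have "ln (r ^ k / M k) \<le> associated_function M r"
    using r by (auto simp: associated_function_def intro: cSUP_upper)
  then show ?thesis
    using r pos[of k] by (metis divide_pos_pos exp_le_cancel_iff exp_ln zero_less_power)
qed

lemma associated_function_leI:
  assumes "weight_sequence M" "0 < r" "\<And>k. r ^ k / M k \<le> exp b"
  shows "associated_function M r \<le> b"
proof -
  have "ln (r ^ k / M k) \<le> b" for k
    using assms weight_sequence_pos[OF assms(1), of k]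
    by (metis divide_pos_pos ln_exp ln_mono zero_less_power exp_gt_zero)
  then show ?thesis
    using assms(2) by (auto simp: associated_function_def intro: cSUP_least)
qed

lemma associated_function_mono:
  assumes M: "weight_sequence M" and "0 < r" "r \<le> s"
  shows "associated_function M r \<le> associated_function M s"
proof (rule associated_function_leI[OF M \<open>0 < r\<close>])
  fix k
  have "r ^ k / M k \<le> s ^ k / M k"
    using assms weight_sequence_pos[OF M, of k] by (intro divide_right_mono power_mono) auto
  also have "\<dots> \<le> exp (associated_function M s)"
    using assms by (intro power_div_le_exp_associated_function) auto
  finally show "r ^ k / M k \<le> exp (associated_function M s)" .
qed

text \<open>By (M.2) the square of the \<open>k\<close>-th term at \<open>t\<close> is at most
  \<open>B\<close> times the \<open>2k\<close>-th term at \<open>H * t\<close>, so twice the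
  associated function at \<open>t\<close> is at most \<open>ln B\<close> plus its value at
  \<open>H * t\<close>. Monotonicity first moves both arguments up to the common
  \<open>t\<close>.\<close>

lemma exp_associated_function_mult_le:
  assumes M: "weight_sequence M"
  obtains B H where "1 \<le> B" "0 < H"
    "\<And>r s t. 0 < r \<Longrightarrow> 0 < s \<Longrightarrow> r \<le> t \<Longrightarrow> s \<le> t \<Longrightarrow>
      exp (associated_function M r) * exp (associated_function M s) \<le> B * exp (associated_function M (H * t))"
proof -
  note pos = weight_sequence_pos[OF M]
  obtain H B where HB: "0 < H" "1 \<le> B" "\<And>k. M (2 * k) \<le> B * H ^ (2 * k) * (M k)\<^sup>2"
    using M unfolding weight_sequence_def by blast
  have double: "2 * associated_function M t \<le> ln B + associated_function M (H * t)" if t: "0 < t" for t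
  proof -
    have "associated_function M t \<le> (ln B + associated_function M (H * t)) / 2"
    proof (rule associated_function_leI[OF M t])
      fix k
      have "(t ^ k / M k)\<^sup>2 = t ^ (2 * k) / (M k)\<^sup>2"
        by (simp add: power_divide power_even_eq)
      also have "\<dots> \<le> t ^ (2 * k) * (B * H ^ (2 * k) / M (2 * k))"
      proof -
        have "1 / (M k)\<^sup>2 \<le> B * H ^ (2 * k) / M (2 * k)"
          using HB(3)[of k] pos[of k] pos[of "2 * k"] by (simp add: field_simps)
        then have "t ^ (2 * k) * (1 / (M k)\<^sup>2) \<le> t ^ (2 * k) * (B * H ^ (2 * k) / M (2 * k))"
          using t by (intro mult_left_mono) simp_all
        then show ?thesis by simp
      qed
      also have "\<dots> = B * ((H * t) ^ (2 * k) / M (2 * k))"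
        by (simp add: power_mult_distrib)
      also have "\<dots> \<le> B * exp (associated_function M (H * t))"
        using HB t by (intro mult_left_mono power_div_le_exp_associated_function[OF M]) auto
      also have "\<dots> = exp (ln B + associated_function M (H * t))"
        using HB by (simp add: exp_add)
      also have "\<dots> = (exp ((ln B + associated_function M (H * t)) / 2))\<^sup>2"
        by (simp flip: exp_of_nat_mult)
      finally show "t ^ k / M k \<le> exp ((ln B + associated_function M (H * t)) / 2)"
        by (rule power2_le_imp_le) simp
    qed
    then show ?thesis by simp
  qed
  have "exp (associated_function M r) * exp (associated_function M s) \<le> B * exp (associated_function M (H * t))"
    if "0 < r" "0 < s" "r \<le> t" "s \<le> t" for r s t
  proof -
    have "associated_function M r + associated_function M s \<le> 2 * associated_function M t"
      using associated_function_mono[OF M that(1,3)] associated_function_mono[OF M that(2,4)] by simp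
    also have "\<dots> \<le> ln B + associated_function M (H * t)"
      using double that by simp
    finally have "exp (associated_function M r + associated_function M s)
        \<le> exp (ln B + associated_function M (H * t))" by simp
    then show ?thesis using HB by (simp add: exp_add)
  qed
  with HB that show thesis by blast
qed


section \<open>Derivatives of matrix entries\<close>

lemma lie_algebraD:
  assumes "X \<in> lie_algebra G n A" "f \<in> smooth_functions n A"
  shows lie_algebra_smooth: "X f \<in> smooth_functions n A"
    and lie_algebra_add: "g \<in> smooth_functions n A \<Longrightarrow> X (\<lambda>x. f x + g x) = (\<lambda>x. X f x + X g x)"
    and lie_algebra_scale: "X (\<lambda>x. c * f x) = (\<lambda>x. c * X f x)"
    and lie_algebra_mult: "g \<in> smooth_functions n A \<Longrightarrow>
      X (\<lambda>x. f x * g x) = (\<lambda>x. X f x * g x + f x * X g x)"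
    and lie_algebra_cnj: "X (\<lambda>x. cnj (f x)) = (\<lambda>x. cnj (X f x))"
    and lie_algebra_left_invariant: "X (\<lambda>x. f (a \<otimes>\<^bsub>G\<^esub> x)) = (\<lambda>x. X f (a \<otimes>\<^bsub>G\<^esub> x))"
  using assms unfolding lie_algebra_def Let_def by blast+

lemma lie_algebra_const:
  assumes "X \<in> lie_algebra G n A" "smooth_atlas n A"
  shows "X (\<lambda>x. c) = (\<lambda>x. 0)"
proof -
  note one = smooth_functions_const[OF assms(2), of 1]
  \<comment> \<open>The Leibniz rule for 1 * 1 reads X 1 = X 1 + X 1.\<close>
  have "X (\<lambda>x. 1) = (\<lambda>x. 0)"
    using lie_algebra_mult[OF assms(1) one one] by (simp add: fun_eq_iff)
  then show ?thesis
    using lie_algebra_scale[OF assms(1) one, of c] by simp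
qed

lemma lie_algebra_sum:
  assumes "X \<in> lie_algebra G n A" "smooth_atlas n A" "\<And>i. i \<in> I \<Longrightarrow> f i \<in> smooth_functions n A"
  shows "X (\<lambda>x. \<Sum>i\<in>I. f i x) = (\<lambda>x. \<Sum>i\<in>I. X (f i) x)"
  using assms(3)
proof (induction I rule: infinite_finite_induct)
  case (insert i I)
  then show ?case
    using lie_algebra_add[OF assms(1), of "f i" "\<lambda>x. \<Sum>i\<in>I. f i x"]
    by (simp add: smooth_functions_sum[OF assms(2)])
qed (use lie_algebra_const[OF assms(1,2)] in simp_all)

lemma lie_algebra_foldr:
  assumes "\<And>j. j \<in> I \<Longrightarrow> Y j \<in> lie_algebra G n A" "w \<in> lists I" "f \<in> smooth_functions n A"
  shows lie_algebra_foldr_smooth: "foldr Y w f \<in> smooth_functions n A"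
    and lie_algebra_foldr_cnj: "foldr Y w (\<lambda>x. cnj (f x)) = (\<lambda>x. cnj (foldr Y w f x))"
proof -
  have "foldr Y w f \<in> smooth_functions n A \<and>
      foldr Y w (\<lambda>x. cnj (f x)) = (\<lambda>x. cnj (foldr Y w f x))"
    using assms(2)
  proof (induction w)
    case (Cons j w)
    then have "Y j \<in> lie_algebra G n A" using assms(1) by blast
    note lie_algebraD[OF this]
    with Cons.IH show ?case by simp
  qed (simp add: assms(3))
  then show "foldr Y w f \<in> smooth_functions n A"
    "foldr Y w (\<lambda>x. cnj (f x)) = (\<lambda>x. cnj (foldr Y w f x))" by auto
qed

lemma sum_rotate:
  "(\<Sum>k\<in>K. \<Sum>m\<in>P. \<Sum>p\<in>Q. F k m p) = (\<Sum>m\<in>P. \<Sum>p\<in>Q. \<Sum>k\<in>K. F k m p)"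
  by (subst sum.swap) (rule sum.cong[OF refl], rule sum.swap)

section \<open>Unitary matrix representations\<close>

lemma mat_adjoint_dims [simp]:
  "dim_row (mat_adjoint A) = dim_col A" "dim_col (mat_adjoint A) = dim_row A"
  by (simp_all add: mat_adjoint_def)

lemma mat_adjoint_index:
  "i < dim_col A \<Longrightarrow> j < dim_row A \<Longrightarrow> mat_adjoint A $$ (i, j) = conjugate (A $$ (j, i))"
  by (simp add: mat_adjoint_def mat_of_rows_index)

lemma unitary_repD:
  assumes "unitary_rep G \<phi>"
  shows unitary_rep_mult: "i < rep_dim G \<phi> \<Longrightarrow> l < rep_dim G \<phi> \<Longrightarrow>
      \<phi> (x \<otimes>\<^bsub>G\<^esub> y) $$ (i, l) = (\<Sum>k<rep_dim G \<phi>. \<phi> x $$ (i, k) * \<phi> y $$ (k, l))"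
    and unitary_rep_orthonormal: "i < rep_dim G \<phi> \<Longrightarrow> l < rep_dim G \<phi> \<Longrightarrow>
      (\<Sum>k<rep_dim G \<phi>. \<phi> x $$ (i, k) * cnj (\<phi> x $$ (l, k))) = (if i = l then 1 else 0)"
    and unitary_rep_idempotent: "e \<otimes>\<^bsub>G\<^esub> e = e \<Longrightarrow> \<phi> e = 1\<^sub>m (rep_dim G \<phi>)"
proof -
  define d where "d = rep_dim G \<phi>"
  have c: "\<phi> x \<in> carrier_mat d d" for x
    using assms by (simp add: unitary_rep_def Let_def d_def)
  have u: "\<phi> x * mat_adjoint (\<phi> x) = 1\<^sub>m d" for x
    using assms by (simp add: unitary_rep_def Let_def d_def)
  have m: "\<phi> (x \<otimes>\<^bsub>G\<^esub> y) = \<phi> x * \<phi> y" for x y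
    using assms by (simp add: unitary_rep_def Let_def)
  have ca: "mat_adjoint (\<phi> x) \<in> carrier_mat d d" for x
    using carrier_matD[OF c[of x]] by (intro carrier_matI) simp_all
  note dims = c[THEN carrier_matD(1)] c[THEN carrier_matD(2)]
  show "\<phi> (x \<otimes>\<^bsub>G\<^esub> y) $$ (i, l) = (\<Sum>k<rep_dim G \<phi>. \<phi> x $$ (i, k) * \<phi> y $$ (k, l))"
    if "i < rep_dim G \<phi>" "l < rep_dim G \<phi>"
    using that by (simp add: m scalar_prod_def dims atLeast0LessThan flip: d_def)
  show "(\<Sum>k<rep_dim G \<phi>. \<phi> x $$ (i, k) * cnj (\<phi> x $$ (l, k))) = (if i = l then 1 else 0)"
    if "i < rep_dim G \<phi>" "l < rep_dim G \<phi>"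
  proof -
    have "(\<phi> x * mat_adjoint (\<phi> x)) $$ (i, l) = (\<Sum>k<d. \<phi> x $$ (i, k) * cnj (\<phi> x $$ (l, k)))"
      using that dims[of x]
      by (simp add: scalar_prod_def atLeast0LessThan mat_adjoint_index flip: d_def)
    then show ?thesis using that by (simp add: u flip: d_def)
  qed
  show "\<phi> e = 1\<^sub>m (rep_dim G \<phi>)" if "e \<otimes>\<^bsub>G\<^esub> e = e"
  proof -
    \<comment> \<open>Unitarity turns both products with the adjoint into the identity matrix, which
      leaves \<open>\<phi> e\<close> alone on the left.\<close>
    have "\<phi> e * (\<phi> e * mat_adjoint (\<phi> e)) = \<phi> e * mat_adjoint (\<phi> e)"
      using m[of e e] that assoc_mult_mat[OF c[of e] c[of e] ca[of e]] by simp
    then show ?thesis using c[of e] by (simp add: u d_def[symmetric])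
  qed
qed

section \<open>Matrix entries under the invariant vector fields\<close>

context compact_lie_group_fourier
begin

lemma basis_lie_algebra: "j < n \<Longrightarrow> Y j \<in> lie_algebra G n A"
  using basis by (simp add: orthonormal_basis_def)

text \<open>The entries of the matrices of the differentiated representation, read off at the
  identity.\<close>

definition generator :: "('a \<Rightarrow> complex mat) \<Rightarrow> nat \<Rightarrow> nat \<Rightarrow> nat \<Rightarrow> complex" where
  "generator \<phi> j k l = Y j (\<lambda>x. \<phi> x $$ (k, l)) \<one>"

context
  fixes \<phi> assumes \<phi>: "\<phi> \<in> R"
begin

lemma representative_unitary: "unitary_rep G \<phi>"
  using representatives \<phi> by (simp add: dual_representatives_def)

lemma entry_one:
  assumes "i < rep_dim G \<phi>" "k < rep_dim G \<phi>"
  shows "\<phi> \<one> $$ (i, k) = (if i = k then 1 else 0)"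
  using assms unitary_rep_idempotent[OF representative_unitary, of \<one>] by simp

text \<open>Left invariance moves the derivative at \<open>g\<close> to the identity; there
  \<open>\<phi> (g \<otimes> x) = \<phi> g * \<phi> x\<close> is differentiated in \<open>x\<close>,
  with \<open>\<phi> g\<close> a constant.\<close>

lemma basis_entry:
  assumes j: "j < n" and il: "i < rep_dim G \<phi>" "l < rep_dim G \<phi>"
  shows "Y j (\<lambda>x. \<phi> x $$ (i, l)) = (\<lambda>x. \<Sum>k<rep_dim G \<phi>. \<phi> x $$ (i, k) * generator \<phi> j k l)"
proof
  fix g
  let ?d = "rep_dim G \<phi>"
  note X = basis_lie_algebra[OF j]
  have "Y j (\<lambda>x. \<phi> x $$ (i, l)) (g \<otimes> \<one>) = Y j (\<lambda>x. \<phi> (g \<otimes> x) $$ (i, l)) \<one>"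
    using lie_algebra_left_invariant[OF X entry_smooth[OF \<phi> il], of g] by (simp add: fun_eq_iff)
  also have "(\<lambda>x. \<phi> (g \<otimes> x) $$ (i, l)) = (\<lambda>x. \<Sum>k<?d. \<phi> g $$ (i, k) * \<phi> x $$ (k, l))"
    using unitary_rep_mult[OF representative_unitary il] by simp
  also have "Y j \<dots> = (\<lambda>x. \<Sum>k<?d. Y j (\<lambda>x. \<phi> g $$ (i, k) * \<phi> x $$ (k, l)) x)"
    using il by (intro lie_algebra_sum[OF X atlas] smooth_functions_scale[OF atlas] entry_smooth[OF \<phi>]) auto
  also have "\<dots> \<one> = (\<Sum>k<?d. \<phi> g $$ (i, k) * generator \<phi> j k l)"
    unfolding generator_def
    by (intro sum.cong refl) (simp add: lie_algebra_scale[OF X entry_smooth[OF \<phi> _ il(2)]])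
  finally show "Y j (\<lambda>x. \<phi> x $$ (i, l)) g = (\<Sum>k<?d. \<phi> g $$ (i, k) * generator \<phi> j k l)"
    using carrier_UNIV by simp
qed

text \<open>Differentiate the orthonormality relations of the rows of \<open>\<phi>\<close> at the
  identity, using that the field commutes with conjugation.\<close>

lemma generator_skew:
  assumes j: "j < n" and il: "i < rep_dim G \<phi>" "l < rep_dim G \<phi>"
  shows "cnj (generator \<phi> j l i) = - generator \<phi> j i l"
proof -
  let ?d = "rep_dim G \<phi>"
  note X = basis_lie_algebra[OF j]
  note S = entry_smooth[OF \<phi>] and C = smooth_functions_cnj[OF atlas entry_smooth[OF \<phi>]]
  have "(\<lambda>x. 0) = Y j (\<lambda>x. \<Sum>k<?d. \<phi> x $$ (i, k) * cnj (\<phi> x $$ (l, k)))"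
    using unitary_rep_orthonormal[OF representative_unitary il] lie_algebra_const[OF X atlas] by simp
  also have "\<dots> = (\<lambda>x. \<Sum>k<?d. Y j (\<lambda>x. \<phi> x $$ (i, k) * cnj (\<phi> x $$ (l, k))) x)"
    using il by (intro lie_algebra_sum[OF X atlas] smooth_functions_mult[OF atlas] S C) auto
  finally have "0 = (\<Sum>k<?d. Y j (\<lambda>x. \<phi> x $$ (i, k) * cnj (\<phi> x $$ (l, k))) \<one>)"
    by (rule fun_cong)
  also have "\<dots> = (\<Sum>k<?d. generator \<phi> j i k * cnj (\<phi> \<one> $$ (l, k)) + \<phi> \<one> $$ (i, k) * cnj (generator \<phi> j l k))"
    unfolding generator_def
    by (intro sum.cong refl)
      (simp add: lie_algebra_mult[OF X S[OF il(1)] C[OF il(2)]] lie_algebra_cnj[OF X S[OF il(2)]])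
  also have "\<dots> = (\<Sum>k<?d. (if k = l then generator \<phi> j i k else 0) + (if k = i then cnj (generator \<phi> j l k) else 0))"
    using il by (intro sum.cong refl) (auto simp: entry_one)
  also have "\<dots> = generator \<phi> j i l + cnj (generator \<phi> j l i)"
    using il by (simp add: sum.distrib sum.delta)
  finally show ?thesis by (simp add: eq_neg_iff_add_eq_0 add.commute)
qed

text \<open>
  The first-order part of the Laplacian contributes a skew-Hermitian matrix at the identity, while the
  sum of the squared generators is Hermitian. Taking adjoints of the eigenvalue equation thus removes
  the former, without any appeal to unimodularity.
\<close>

lemma generator_casimir:
  assumes pm: "p < rep_dim G \<phi>" "m < rep_dim G \<phi>"
  shows "(\<Sum>j<n. \<Sum>k<rep_dim G \<phi>. generator \<phi> j p k * generator \<phi> j k m) = (if p = m then - of_real (\<nu> \<phi>) else 0)"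
proof -
  let ?d = "rep_dim G \<phi>"
  define E where "E p m = (\<Sum>j<n. \<Sum>k<?d. generator \<phi> j p k * generator \<phi> j k m)" for p m
  define c where "c k = (\<Sum>j<n. levi_civita ip (Y j) (Y k) (Y j))" for k
  define D where "D p m = (\<Sum>k<n. generator \<phi> k p m * of_real (c k))" for p m
  have *: "E p m + D p m = (if p = m then - of_real (\<nu> \<phi>) else 0)" if pm: "p < ?d" "m < ?d" for p m
  proof -
    have YY: "Y j (Y j (\<lambda>x. \<phi> x $$ (p, m))) \<one> = (\<Sum>k<?d. generator \<phi> j p k * generator \<phi> j k m)"
      if j: "j < n" for j
    proof -
      note X = basis_lie_algebra[OF j]
      have "Y j (Y j (\<lambda>x. \<phi> x $$ (p, m))) = Y j (\<lambda>x. \<Sum>k<?d. generator \<phi> j k m * \<phi> x $$ (p, k))"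
        unfolding basis_entry[OF j pm] by (simp add: mult.commute)
      also have "\<dots> = (\<lambda>x. \<Sum>k<?d. Y j (\<lambda>x. generator \<phi> j k m * \<phi> x $$ (p, k)) x)"
        using pm by (intro lie_algebra_sum[OF X atlas] smooth_functions_scale[OF atlas] entry_smooth[OF \<phi>]) auto
      finally have "Y j (Y j (\<lambda>x. \<phi> x $$ (p, m))) \<one> = (\<Sum>k<?d. Y j (\<lambda>x. generator \<phi> j k m * \<phi> x $$ (p, k)) \<one>)"
        by simp
      also have "\<dots> = (\<Sum>k<?d. generator \<phi> j p k * generator \<phi> j k m)"
        by (intro sum.cong refl)
          (simp add: lie_algebra_scale[OF X entry_smooth[OF \<phi> pm(1)]] generator_def)
      finally show ?thesis .
    qed
    have "laplace_beltrami n ip Y (\<lambda>x. \<phi> x $$ (p, m)) \<one> = E p m + D p m"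
      by (simp add: laplace_beltrami_def divergence_def YY E_def D_def c_def generator_def)
    then have "- (E p m + D p m) = of_real (\<nu> \<phi>) * (if p = m then 1 else 0)"
      using entry_eigenfunction[OF \<phi> pm, of \<one>] entry_one[OF pm] by simp
    then have "E p m + D p m = - (of_real (\<nu> \<phi>) * (if p = m then 1 else 0))"
      by (metis minus_minus)
    then show ?thesis by simp
  qed
  have "cnj (E m p) = (\<Sum>j<n. \<Sum>k<?d. cnj (generator \<phi> j k p) * cnj (generator \<phi> j m k))"
    unfolding E_def by (simp add: mult.commute)
  also have "\<dots> = E p m"
    unfolding E_def using pm by (intro sum.cong refl) (simp add: generator_skew)
  finally have cE: "cnj (E m p) = E p m" .
  have cD: "cnj (D m p) = - D p m"
    using pm by (simp add: D_def generator_skew flip: sum_negf)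
  have "E p m - D p m = (if p = m then - of_real (\<nu> \<phi>) else 0)"
    using arg_cong[OF *[OF pm(2,1)], of cnj] by (auto simp: cE cD split: if_splits)
  moreover have "2 * E p m = (E p m + D p m) + (E p m - D p m)" by simp
  ultimately have "E p m = (if p = m then - of_real (\<nu> \<phi>) else 0)"
    unfolding *[OF pm] by simp
  then show ?thesis by (simp add: E_def)
qed

text \<open>Skewness turns the squared length of the image of \<open>v\<close> under a generator
  into minus the form of the squared generator at \<open>v\<close>; the sum over \<open>j\<close> is
  then given by the preceding identity. The computation is complex and is read back in the
  reals.\<close>

lemma generator_energy:
  "(\<Sum>j<n. \<Sum>k<rep_dim G \<phi>. (cmod (\<Sum>m<rep_dim G \<phi>. generator \<phi> j k m * v m))\<^sup>2)
    = \<nu> \<phi> * (\<Sum>k<rep_dim G \<phi>. (cmod (v k))\<^sup>2)"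
proof -
  let ?d = "rep_dim G \<phi>"
  have "complex_of_real (\<Sum>j<n. \<Sum>k<?d. (cmod (\<Sum>m<?d. generator \<phi> j k m * v m))\<^sup>2)
    = (\<Sum>j<n. \<Sum>k<?d. (\<Sum>m<?d. generator \<phi> j k m * v m) * cnj (\<Sum>p<?d. generator \<phi> j k p * v p))"
    by (simp add: complex_norm_square del: of_real_power cnj_sum)
  also have "\<dots> = (\<Sum>j<n. \<Sum>k<?d. \<Sum>m<?d. \<Sum>p<?d. - (v m * cnj (v p) * (generator \<phi> j p k * generator \<phi> j k m)))"
    by (intro sum.cong refl) (simp add: sum_product generator_skew mult_ac)
  \<comment> \<open>The sums over \<open>j\<close> and \<open>k\<close> go innermost, where they
    form the sum of squared generators.\<close>
  also have "\<dots> = (\<Sum>m<?d. \<Sum>p<?d. \<Sum>j<n. \<Sum>k<?d. - (v m * cnj (v p) * (generator \<phi> j p k * generator \<phi> j k m)))"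
    by (rule trans[OF sum.cong[OF refl sum_rotate] sum_rotate])
  also have "\<dots> = (\<Sum>m<?d. \<Sum>p<?d. - (v m * cnj (v p) * (\<Sum>j<n. \<Sum>k<?d. generator \<phi> j p k * generator \<phi> j k m)))"
    by (simp add: sum_distrib_left sum_negf)
  also have "\<dots> = (\<Sum>m<?d. \<Sum>p<?d. if p = m then v m * cnj (v m) * of_real (\<nu> \<phi>) else 0)"
    by (intro sum.cong refl) (auto simp: generator_casimir)
  also have "\<dots> = (\<Sum>m<?d. v m * cnj (v m) * of_real (\<nu> \<phi>))"
    by (intro sum.cong refl) (simp add: sum.delta)
  also have "\<dots> = complex_of_real (\<nu> \<phi> * (\<Sum>k<?d. (cmod (v k))\<^sup>2))"
    by (simp add: complex_norm_square sum_distrib_left mult_ac del: of_real_power)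
  finally show ?thesis using of_real_eq_iff by blast
qed


text \<open>A word of derivatives turns entry \<open>(i, l)\<close> into a linear combination of the
  entries of row \<open>i\<close>, with constant coefficients whose squared length is controlled by
  the energy identity. Cauchy-Schwarz against a row of a unitary matrix gives a bound free of the
  dimension.\<close>

lemma foldr_basis_entry_le:
  assumes w: "w \<in> lists {..<n}" and il: "i < rep_dim G \<phi>" "l < rep_dim G \<phi>"
  shows "cmod (foldr Y w (\<lambda>x. \<phi> x $$ (i, l)) x) \<le> japanese_bracket \<nu> \<phi> ^ length w"
proof -
  let ?d = "rep_dim G \<phi>"
  \<comment> \<open>The coefficient vector: the generators of the letters of \<open>w\<close>,
    applied to the \<open>l\<close>-th unit vector.\<close>
  define b where "b w = foldr (\<lambda>j v k. \<Sum>m<?d. generator \<phi> j k m * v m) w (\<lambda>k. if k = l then 1 else 0)" for w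
  have b_Cons: "b (j # w) k = (\<Sum>m<?d. generator \<phi> j k m * b w m)" for j w k
    by (simp add: b_def)
  have repr: "foldr Y w (\<lambda>x. \<phi> x $$ (i, l)) = (\<lambda>x. \<Sum>k<?d. b w k * \<phi> x $$ (i, k))"
    using w
  proof (induction w)
    case Nil
    show ?case using il by (simp add: b_def sum.delta if_distrib[of "\<lambda>z. z * _"] cong: if_cong)
  next
    case (Cons j w)
    then have j: "j < n" by simp
    note X = basis_lie_algebra[OF j]
    have "foldr Y (j # w) (\<lambda>x. \<phi> x $$ (i, l)) = Y j (\<lambda>x. \<Sum>k<?d. b w k * \<phi> x $$ (i, k))"
      by (simp add: Cons.IH)
    also have "\<dots> = (\<lambda>x. \<Sum>k<?d. Y j (\<lambda>x. b w k * \<phi> x $$ (i, k)) x)"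
      using il by (intro lie_algebra_sum[OF X atlas] smooth_functions_scale[OF atlas] entry_smooth[OF \<phi>]) auto
    also have "\<dots> = (\<lambda>x. \<Sum>m<?d. \<Sum>k<?d. b w m * (\<phi> x $$ (i, k) * generator \<phi> j k m))"
      by (intro ext sum.cong refl)
        (simp add: lie_algebra_scale[OF X entry_smooth[OF \<phi> il(1)]] basis_entry[OF j il(1)] sum_distrib_left)
    also have "\<dots> = (\<lambda>x. \<Sum>k<?d. b (j # w) k * \<phi> x $$ (i, k))"
      by (subst sum.swap) (simp add: b_Cons sum_distrib_left mult_ac)
    finally show ?case .
  qed
  have norm: "(\<Sum>k<?d. (cmod (b w k))\<^sup>2) \<le> \<nu> \<phi> ^ length w"
    using w
  proof (induction w)
    case Nil
    show ?case using il by (simp add: b_def sum.delta if_distrib[of "\<lambda>z. (cmod z)\<^sup>2"] cong: if_cong)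
  next
    case (Cons j w)
    \<comment> \<open>A single generator is bounded by the sum over all of them, for which the
      energy is known exactly.\<close>
    have "(\<Sum>k<?d. (cmod (b (j # w) k))\<^sup>2) \<le> (\<Sum>j<n. \<Sum>k<?d. (cmod (\<Sum>m<?d. generator \<phi> j k m * b w m))\<^sup>2)"
      unfolding b_Cons using Cons.hyps by (intro member_le_sum) (auto intro: sum_nonneg)
    also have "\<dots> = \<nu> \<phi> * (\<Sum>k<?d. (cmod (b w k))\<^sup>2)" by (rule generator_energy)
    also have "\<dots> \<le> \<nu> \<phi> * \<nu> \<phi> ^ length w"
      using Cons.IH eigenvalue_nonneg[OF \<phi>] by (rule mult_left_mono)
    finally show ?case by simp
  qed
  \<comment> \<open>Rows of a unitary matrix are unit vectors.\<close>
  have row: "(\<Sum>k<?d. (cmod (\<phi> x $$ (i, k)))\<^sup>2) = 1"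
  proof -
    have "complex_of_real (\<Sum>k<?d. (cmod (\<phi> x $$ (i, k)))\<^sup>2) = 1"
      using unitary_rep_orthonormal[OF representative_unitary il(1) il(1), of x]
      by (simp add: complex_norm_square del: of_real_power)
    then show ?thesis using of_real_eq_1_iff by blast
  qed
  have "cmod (foldr Y w (\<lambda>x. \<phi> x $$ (i, l)) x) \<le> (\<Sum>k<?d. \<bar>cmod (b w k)\<bar> * \<bar>cmod (\<phi> x $$ (i, k))\<bar>)"
    unfolding repr by (rule order_trans[OF norm_sum]) (simp add: norm_mult)
  also have "\<dots> \<le> L2_set (\<lambda>k. cmod (b w k)) {..<?d} * L2_set (\<lambda>k. cmod (\<phi> x $$ (i, k))) {..<?d}"
    by (rule L2_set_mult_ineq)
  also have "\<dots> \<le> sqrt (\<nu> \<phi> ^ length w)"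
    unfolding L2_set_def row using norm by simp
  also have "\<dots> \<le> sqrt ((1 + \<nu> \<phi>) ^ length w)"
    using eigenvalue_nonneg[OF \<phi>] by (intro real_sqrt_le_mono power_mono) auto
  finally show ?thesis by (simp add: japanese_bracket_def real_sqrt_power)
qed

lemma conj_entry_smooth:
  assumes "i < rep_dim G \<phi>" "l < rep_dim G \<phi>"
  shows "conj_entry \<phi> i l \<in> smooth_functions n A"
  unfolding conj_entry_def by (rule smooth_functions_cnj[OF atlas entry_smooth[OF \<phi> assms]])

text \<open>The fields are real, so the bound passes to conjugate entries, which are the functions
  that occur in Fourier coefficients.\<close>

lemma foldr_basis_conj_entry_le:
  assumes "w \<in> lists {..<n}" "i < rep_dim G \<phi>" "l < rep_dim G \<phi>"
  shows "cmod (foldr Y w (conj_entry \<phi> i l) x) \<le> japanese_bracket \<nu> \<phi> ^ length w"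
proof -
  have "foldr Y w (conj_entry \<phi> i l) = (\<lambda>x. cnj (foldr Y w (\<lambda>x. \<phi> x $$ (i, l)) x))"
    unfolding conj_entry_def
    by (rule lie_algebra_foldr_cnj[where G = G, OF _ assms(1) entry_smooth[OF \<phi> assms(2,3)]])
      (simp add: basis_lie_algebra)
  then show ?thesis using foldr_basis_entry_le[OF assms] by simp
qed

lemma japanese_bracket_ge_1: "1 \<le> japanese_bracket \<nu> \<phi>"
  using eigenvalue_nonneg[OF \<phi>] by (simp add: japanese_bracket_def)

end

end


section \<open>Norms and linear functionals\<close>

lemma integrable_cmod_square:
  assumes "finite_measure \<mu>" "sets \<mu> = sets borel"
    and "compact (UNIV :: 'a :: topological_space set)" "continuous_on UNIV (f :: 'a \<Rightarrow> complex)"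
  shows "integrable \<mu> (\<lambda>x. (cmod (f x))\<^sup>2)"
proof -
  have cont: "continuous_on UNIV (\<lambda>x. (cmod (f x))\<^sup>2)" by (intro continuous_intros assms)
  then have "bounded ((\<lambda>x. (cmod (f x))\<^sup>2) ` UNIV)"
    by (intro compact_imp_bounded compact_continuous_image assms)
  then obtain B where "\<And>x. norm ((cmod (f x))\<^sup>2) \<le> B"
    unfolding bounded_iff by auto
  moreover have "(\<lambda>x. (cmod (f x))\<^sup>2) \<in> borel_measurable \<mu>"
    using borel_measurable_continuous_onI[OF cont] measurable_cong_sets[OF assms(2) refl] by blast
  ultimately show ?thesis
    by (intro finite_measure.integrable_const_bound[OF assms(1)]) auto
qed

lemma l2_norm_nonneg [simp]: "0 \<le> l2_norm \<mu> f"
  by (simp add: l2_norm_def)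

lemma l2_norm_power2: "(l2_norm \<mu> f)\<^sup>2 = (LINT x|\<mu>. (cmod (f x))\<^sup>2)"
  by (simp add: l2_norm_def)

text \<open>A weak form of Minkowski's inequality from \<open>(a + b)^2 \<le> 2 a^2 + 2 b^2\<close>;
  the factors 2 are harmless, because the Beurling condition allows any constant.\<close>

lemma l2_norm_add_scale_le:
  assumes f: "integrable \<mu> (\<lambda>x. (cmod (f x))\<^sup>2)" and g: "integrable \<mu> (\<lambda>x. (cmod (g x))\<^sup>2)"
  shows "l2_norm \<mu> (\<lambda>x. f x + c * g x) \<le> 2 * l2_norm \<mu> f + 2 * cmod c * l2_norm \<mu> g"
proof (rule power2_le_imp_le)
  have le: "(cmod (f x + c * g x))\<^sup>2 \<le> 2 * (cmod (f x))\<^sup>2 + 2 * (cmod c)\<^sup>2 * (cmod (g x))\<^sup>2" for x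
  proof -
    have "(cmod (f x + c * g x))\<^sup>2 \<le> (cmod (f x) + cmod c * cmod (g x))\<^sup>2"
      by (intro power_mono) (simp_all add: norm_triangle_le norm_mult)
    also have "\<dots> \<le> 2 * (cmod (f x))\<^sup>2 + 2 * (cmod c * cmod (g x))\<^sup>2"
      using sum_squares_bound[of "cmod (f x)" "cmod c * cmod (g x)"] by (simp add: power2_sum)
    finally show ?thesis by (simp add: power_mult_distrib)
  qed
  have "(l2_norm \<mu> (\<lambda>x. f x + c * g x))\<^sup>2 \<le> (LINT x|\<mu>. 2 * (cmod (f x))\<^sup>2 + 2 * (cmod c)\<^sup>2 * (cmod (g x))\<^sup>2)"
    unfolding l2_norm_power2 using f g by (intro integral_mono_AE' AE_I2 le) auto
  also have "\<dots> = 2 * (l2_norm \<mu> f)\<^sup>2 + 2 * (cmod c)\<^sup>2 * (l2_norm \<mu> g)\<^sup>2"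
    using f g by (simp add: l2_norm_power2)
  also have "\<dots> \<le> (2 * l2_norm \<mu> f)\<^sup>2 + (2 * (cmod c * l2_norm \<mu> g))\<^sup>2"
    by (simp add: power_mult_distrib mult_mono)
  also have "\<dots> \<le> (2 * l2_norm \<mu> f + 2 * (cmod c * l2_norm \<mu> g))\<^sup>2"
    by (simp add: power2_sum)
  finally show "(l2_norm \<mu> (\<lambda>x. f x + c * g x))\<^sup>2 \<le> (2 * l2_norm \<mu> f + 2 * cmod c * l2_norm \<mu> g)\<^sup>2"
    by (simp add: mult.assoc)
qed simp

lemma l2_norm_le:
  assumes "prob_space \<mu>" "integrable \<mu> (\<lambda>x. (cmod (f x))\<^sup>2)" "\<And>x. cmod (f x) \<le> K"
  shows "l2_norm \<mu> f \<le> K"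
proof -
  interpret prob_space \<mu> by fact
  have "0 \<le> K" using assms(3) norm_ge_zero order_trans by blast
  have "(LINT x|\<mu>. (cmod (f x))\<^sup>2) \<le> (LINT x|\<mu>. K\<^sup>2)"
    using assms(2,3) by (intro integral_mono power_mono) auto
  also have "\<dots> = K\<^sup>2" by (simp add: prob_space)
  finally show ?thesis
    unfolding l2_norm_def using \<open>0 \<le> K\<close> by (simp add: real_le_lsqrt)
qed

text \<open>Once the second factor is bounded pointwise, the integrand depends on the first
  coordinate alone and is integrated against the first marginal. That marginal is
  \<open>\<mu>1\<close> because \<open>\<mu>2\<close> is a probability measure.\<close>

lemma l2_norm_tensor_le:
  assumes \<mu>1: "prob_space \<mu>1" and \<mu>2: "prob_space \<mu>2" and f: "integrable \<mu>1 (\<lambda>x. (cmod (f x))\<^sup>2)"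
    and K: "\<And>y. cmod (g y) \<le> K"
  shows "l2_norm (\<mu>1 \<Otimes>\<^sub>M \<mu>2) (tensor f g) \<le> K * l2_norm \<mu>1 f"
proof (rule power2_le_imp_le)
  interpret \<mu>2: prob_space \<mu>2 by fact
  have "0 \<le> K" using K norm_ge_zero order_trans by blast
  note distr_fst = \<mu>2.distr_pair_fst[of \<mu>1]
  have meas: "(\<lambda>x. (cmod (f x))\<^sup>2) \<in> borel_measurable \<mu>1" using f by simp
  have "integrable (distr (\<mu>1 \<Otimes>\<^sub>M \<mu>2) \<mu>1 fst) (\<lambda>x. (cmod (f x))\<^sup>2)" using f distr_fst by simp
  then have int: "integrable (\<mu>1 \<Otimes>\<^sub>M \<mu>2) (\<lambda>z. (cmod (f (fst z)))\<^sup>2)"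
    by (simp add: integrable_distr_eq[OF measurable_fst meas])
  have "(l2_norm (\<mu>1 \<Otimes>\<^sub>M \<mu>2) (tensor f g))\<^sup>2 \<le> (LINT z|(\<mu>1 \<Otimes>\<^sub>M \<mu>2). K\<^sup>2 * (cmod (f (fst z)))\<^sup>2)"
    unfolding l2_norm_power2
  proof (intro integral_mono_AE' AE_I2)
    show "(cmod (tensor f g z))\<^sup>2 \<le> K\<^sup>2 * (cmod (f (fst z)))\<^sup>2" for z
      using mult_right_mono[OF power_mono[OF K[of "snd z"] norm_ge_zero, of 2], of "(cmod (f (fst z)))\<^sup>2"]
      by (simp add: tensor_def split_beta norm_mult power_mult_distrib mult.commute)
  qed (use int in auto)
  also have "\<dots> = K\<^sup>2 * (LINT x|distr (\<mu>1 \<Otimes>\<^sub>M \<mu>2) \<mu>1 fst. (cmod (f x))\<^sup>2)"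
    by (simp add: integral_distr[OF measurable_fst meas])
  also have "\<dots> = (K * l2_norm \<mu>1 f)\<^sup>2"
    by (simp add: distr_fst power_mult_distrib l2_norm_power2)
  finally show "(l2_norm (\<mu>1 \<Otimes>\<^sub>M \<mu>2) (tensor f g))\<^sup>2 \<le> (K * l2_norm \<mu>1 f)\<^sup>2" .
  show "0 \<le> K * l2_norm \<mu>1 f" using \<open>0 \<le> K\<close> by simp
qed

lemma beurling_class_bound:
  assumes "f \<in> beurling_class M S I Y \<mu>" "0 < h"
  obtains C where "0 < C" "\<And>w. w \<in> lists I \<Longrightarrow> l2_norm \<mu> (foldr Y w f) \<le> C * h ^ length w * M (length w)"
  using assms unfolding beurling_class_def by auto

text \<open>Links the two families of seminorms: \<open>h\<close> in the norm corresponds to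
  \<open>1 / h\<close> in the continuity condition for ultradistributions.\<close>

lemma ultra_norm_eq:
  assumes "weight_sequence M" "0 < h"
  shows "ultra_norm M I Y h \<phi> = (SUP w \<in> lists I.
    ennreal ((1 / h) ^ length w / M (length w)) * (SUP x. ennreal (cmod (foldr Y w \<phi> x))))"
proof -
  have "ennreal (cmod z / (h ^ k * M k)) = ennreal ((1 / h) ^ k / M k) * ennreal (cmod z)" for z k
    using assms weight_sequence_pos[OF assms(1), of k]
    by (subst ennreal_mult[symmetric]) (auto simp: power_one_over field_simps)
  then show ?thesis
    by (simp add: ultra_norm_def SUP_mult_left_ennreal)
qed

lemma complex_spanI:
  assumes "\<And>i. i < (k :: nat) \<Longrightarrow> f i \<in> B"
  shows "(\<lambda>x. \<Sum>i<k. c i * f i x) \<in> complex_span B"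
  using assms unfolding complex_span_def by blast

lemma linear_on_scale: "linear_on V u \<Longrightarrow> f \<in> V \<Longrightarrow> u (\<lambda>x. c * f x) = c * u f"
  by (simp add: linear_on_def)

text \<open>Linearity on \<open>V\<close> says nothing about \<open>V\<close> being a subspace, so
  multiples and partial sums are placed in \<open>V\<close> by hypothesis. The empty sum is treated
  as 0 times the zero function.\<close>

lemma linear_on_sum:
  assumes u: "linear_on V u" and zero: "(\<lambda>x. 0) \<in> V"
    and partial: "\<And>m. m \<le> k \<Longrightarrow> (\<lambda>x. \<Sum>i<m. c i * f i x) \<in> V"
    and f: "\<And>i. i < k \<Longrightarrow> f i \<in> V" "\<And>i. i < k \<Longrightarrow> (\<lambda>x. c i * f i x) \<in> V"
  shows "u (\<lambda>x. \<Sum>i<(k::nat). c i * f i x) = (\<Sum>i<k. c i * u (f i))"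
  using partial f
proof (induction k)
  case 0
  show ?case using linear_on_scale[OF u zero, of 0] by simp
next
  case (Suc k)
  have "u (\<lambda>x. (\<Sum>i<k. c i * f i x) + c k * f k x) = u (\<lambda>x. \<Sum>i<k. c i * f i x) + u (\<lambda>x. c k * f k x)"
    using u Suc.prems(1)[of k] Suc.prems(3)[of k] unfolding linear_on_def by simp
  also have "u (\<lambda>x. c k * f k x) = c k * u (f k)"
    by (intro linear_on_scale[OF u] Suc.prems(2)) simp
  finally show ?case using Suc by simp
qed


section \<open>Tensors in the Beurling class of the product\<close>

locale compact_lie_group_fourier_pair =
  F1: compact_lie_group_fourier G1 n1 A1 \<mu>1 ip1 Y1 R1 \<nu>1 +
  F2: compact_lie_group_fourier G2 n2 A2 \<mu>2 ip2 Y2 R2 \<nu>2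
  for G1 :: "'a::{second_countable_topology, t2_space} monoid"
    and n1 A1 \<mu>1 ip1 Y1 R1 \<nu>1
    and G2 :: "'b::{second_countable_topology, t2_space} monoid"
    and n2 A2 \<mu>2 ip2 Y2 R2 \<nu>2 +
  fixes M :: "nat \<Rightarrow> real"
  assumes M: "weight_sequence M"
begin

abbreviation "S1 \<equiv> smooth_functions n1 A1"
abbreviation "S2 \<equiv> smooth_functions n2 A2"
abbreviation "\<Gamma>1 \<equiv> group_beurling_class M n1 A1 \<mu>1 Y1"
abbreviation "PY \<equiv> prod_basis Y1 Y2"
abbreviation "J \<equiv> {..<n1} <+> {..<n2}"
abbreviation "\<Gamma> \<equiv> beurling_class M (smooth_functions (n1 + n2) (prod_atlas n1 A1 A2)) J PY (\<mu>1 \<Otimes>\<^sub>M \<mu>2)"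

lemma \<mu>1: "prob_space \<mu>1" "sets \<mu>1 = sets borel" and \<mu>2: "prob_space \<mu>2" "sets \<mu>2 = sets borel"
  using F1.haar F2.haar by (auto simp: haar_measure_def)

lemma prod_measure: "prob_space (\<mu>1 \<Otimes>\<^sub>M \<mu>2)" "sets (\<mu>1 \<Otimes>\<^sub>M \<mu>2) = sets borel"
proof -
  interpret pair_prob_space \<mu>1 \<mu>2 using \<mu>1 \<mu>2
    by (simp add: pair_prob_space_def pair_sigma_finite_def prob_space_imp_sigma_finite)
  show "prob_space (\<mu>1 \<Otimes>\<^sub>M \<mu>2)" by (rule P.prob_space_axioms)
  show "sets (\<mu>1 \<Otimes>\<^sub>M \<mu>2) = sets borel"
    \<comment> \<open>Second countability of both topologies makes the product sigma-algebra the
      Borel one.\<close>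
    using sets_pair_measure_cong[OF \<mu>1(2) \<mu>2(2)] unfolding borel_prod .
qed

lemma smooth_square_integrable: "f \<in> S1 \<Longrightarrow> integrable \<mu>1 (\<lambda>x. (cmod (f x))\<^sup>2)"
  using \<mu>1 by (intro integrable_cmod_square F1.compact_UNIV smooth_functions_continuous[OF F1.atlas])
    (auto simp: prob_space_def)

lemma tensor_sums_square_integrable:
  assumes "F \<in> tensor_sums S1 S2"
  shows "integrable (\<mu>1 \<Otimes>\<^sub>M \<mu>2) (\<lambda>z. (cmod (F z))\<^sup>2)"
proof (rule integrable_cmod_square)
  show "finite_measure (\<mu>1 \<Otimes>\<^sub>M \<mu>2)" "sets (\<mu>1 \<Otimes>\<^sub>M \<mu>2) = sets borel"
    using prod_measure by (auto simp: prob_space_def)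
  show "compact (UNIV :: ('a \<times> 'b) set)"
    using compact_Times[OF F1.compact_UNIV F2.compact_UNIV] by simp
  show "continuous_on UNIV F"
    using assms
  proof induction
    case (tensor \<phi> \<psi>)
    have "continuous_on UNIV (\<lambda>z :: 'a \<times> 'b. \<phi> (fst z))" "continuous_on UNIV (\<lambda>z :: 'a \<times> 'b. \<psi> (snd z))"
      using continuous_on_compose2[OF smooth_functions_continuous[OF F1.atlas tensor(1)] continuous_on_fst[OF continuous_on_id]]
        continuous_on_compose2[OF smooth_functions_continuous[OF F2.atlas tensor(2)] continuous_on_snd[OF continuous_on_id]]
      by auto
    then show ?case
      unfolding tensor_def split_beta by (rule continuous_on_mult)
  qed (intro continuous_intros)
qed

lemma prod_basis_tensor:
  assumes "\<phi> \<in> S1" "\<psi> \<in> S2"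
  shows "j < n1 \<Longrightarrow> PY (Inl j) (tensor \<phi> \<psi>) = tensor (Y1 j \<phi>) \<psi>"
    and "j < n2 \<Longrightarrow> PY (Inr j) (tensor \<phi> \<psi>) = tensor \<phi> (Y2 j \<psi>)"
proof -
  show "PY (Inl j) (tensor \<phi> \<psi>) = tensor (Y1 j \<phi>) \<psi>" if "j < n1"
    using lie_algebra_scale[OF F1.basis_lie_algebra[OF that] assms(1)]
    by (simp add: tensor_def fun_eq_iff mult.commute[of _ "\<psi> _"])
  show "PY (Inr j) (tensor \<phi> \<psi>) = tensor \<phi> (Y2 j \<psi>)" if "j < n2"
    using lie_algebra_scale[OF F2.basis_lie_algebra[OF that] assms(2)]
    by (simp add: tensor_def fun_eq_iff)
qed

text \<open>Every letter acts on one factor and leaves the other alone, so a word splits into its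
  letters for either factor, in the given order.\<close>

lemma foldr_prod_basis_tensor:
  assumes "w \<in> lists J" "\<phi> \<in> S1" "\<psi> \<in> S2"
  obtains w1 w2 where "w1 \<in> lists {..<n1}" "w2 \<in> lists {..<n2}" "length w1 + length w2 = length w"
    "foldr PY w (tensor \<phi> \<psi>) = tensor (foldr Y1 w1 \<phi>) (foldr Y2 w2 \<psi>)"
proof -
  have "\<exists>w1\<in>lists {..<n1}. \<exists>w2\<in>lists {..<n2}. length w1 + length w2 = length w \<and>
      foldr PY w (tensor \<phi> \<psi>) = tensor (foldr Y1 w1 \<phi>) (foldr Y2 w2 \<psi>)"
    using assms(1)
  proof (induction w)
    case (Cons i w)
    then obtain w1 w2 where w: "w1 \<in> lists {..<n1}" "w2 \<in> lists {..<n2}"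
      "length w1 + length w2 = length w"
      "foldr PY w (tensor \<phi> \<psi>) = tensor (foldr Y1 w1 \<phi>) (foldr Y2 w2 \<psi>)" by blast
    have S: "foldr Y1 w1 \<phi> \<in> S1" "foldr Y2 w2 \<psi> \<in> S2"
      using lie_algebra_foldr_smooth[OF _ w(1) assms(2), of Y1 G1] F1.basis_lie_algebra
        lie_algebra_foldr_smooth[OF _ w(2) assms(3), of Y2 G2] F2.basis_lie_algebra by auto
    from Cons.hyps(1) consider j where "i = Inl j" "j < n1" | j where "i = Inr j" "j < n2" by auto
    then show ?case
    proof cases
      case 1
      then show ?thesis
        using w prod_basis_tensor(1)[OF S] by (intro bexI[of _ "j # w1"] bexI[of _ w2]) auto
    next
      case 2
      then show ?thesis
        using w prod_basis_tensor(2)[OF S] by (intro bexI[of _ w1] bexI[of _ "j # w2"]) auto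
    qed
  qed auto
  then show thesis using that by blast
qed

text \<open>Product fields act on slices, and the rules for elements of the Lie algebra hold only on
  smooth functions; this makes them applicable.\<close>

lemma tensor_sums_slices:
  assumes "F \<in> tensor_sums S1 S2"
  shows "(\<lambda>x. F (x, y)) \<in> S1" "(\<lambda>y. F (x, y)) \<in> S2"
proof -
  show "(\<lambda>x. F (x, y)) \<in> S1"
    using assms
  proof induction
    case (tensor \<phi> \<psi>)
    then show ?case
      using smooth_functions_scale[OF F1.atlas tensor(1), of "\<psi> y"] by (simp add: tensor_def mult.commute)
  qed (rule smooth_functions_add[OF F1.atlas])
  show "(\<lambda>y. F (x, y)) \<in> S2"
    using assms
  proof induction
    case (tensor \<phi> \<psi>)
    then show ?case
      using smooth_functions_scale[OF F2.atlas tensor(2), of "\<phi> x"] by (simp add: tensor_def)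
  qed (rule smooth_functions_add[OF F2.atlas])
qed

lemma tensor_sums_scale:
  assumes "F \<in> tensor_sums S1 S2"
  shows "(\<lambda>z. c * F z) \<in> tensor_sums S1 S2"
  using assms
proof induction
  case (tensor \<phi> \<psi>)
  have "(\<lambda>z. c * tensor \<phi> \<psi> z) = tensor (\<lambda>x. c * \<phi> x) \<psi>"
    by (simp add: tensor_def fun_eq_iff)
  then show ?case
    using tensor_sums.tensor[OF smooth_functions_scale[OF F1.atlas tensor(1)] tensor(2)] by simp
next
  case (add f g)
  then show ?case using tensor_sums.add[OF add.IH] by (simp add: distrib_left)
qed

text \<open>Addition and scaling in one rule: \<open>c = 1\<close> gives additivity, and
  \<open>c = -1\<close> will give the value at the zero function.\<close>

lemma prod_basis_add_scale:
  assumes "i \<in> J" "F \<in> tensor_sums S1 S2" "H \<in> tensor_sums S1 S2"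
  shows "PY i (\<lambda>z. F z + c * H z) = (\<lambda>z. PY i F z + c * PY i H z)"
proof -
  from assms(1) consider j where "i = Inl j" "j < n1" | j where "i = Inr j" "j < n2" by auto
  then show ?thesis
  proof cases
    case 1
    note X = F1.basis_lie_algebra[OF 1(2)]
    show ?thesis
      using lie_algebra_add[OF X tensor_sums_slices(1)[OF assms(2)]
          smooth_functions_scale[OF F1.atlas tensor_sums_slices(1)[OF assms(3)]]]
        lie_algebra_scale[OF X tensor_sums_slices(1)[OF assms(3)]]
      by (simp add: 1 fun_eq_iff)
  next
    case 2
    note X = F2.basis_lie_algebra[OF 2(2)]
    show ?thesis
      using lie_algebra_add[OF X tensor_sums_slices(2)[OF assms(2)]
          smooth_functions_scale[OF F2.atlas tensor_sums_slices(2)[OF assms(3)]]]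
        lie_algebra_scale[OF X tensor_sums_slices(2)[OF assms(3)]]
      by (simp add: 2 fun_eq_iff)
  qed
qed

lemma prod_basis_tensor_sums:
  assumes i: "i \<in> J" and F: "F \<in> tensor_sums S1 S2"
  shows "PY i F \<in> tensor_sums S1 S2"
  using F
proof induction
  case (tensor \<phi> \<psi>)
  from i consider j where "i = Inl j" "j < n1" | j where "i = Inr j" "j < n2" by auto
  then show ?case
    using prod_basis_tensor[OF tensor]
      lie_algebra_smooth[OF F1.basis_lie_algebra tensor(1)] lie_algebra_smooth[OF F2.basis_lie_algebra tensor(2)]
    by cases (auto intro: tensor_sums.tensor tensor)
next
  case (add f g)
  then show ?case
    using tensor_sums.add[OF add.IH] prod_basis_add_scale[OF i add.hyps, of 1] by simp
qed

lemma foldr_prod_basis_add_scale: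
  assumes w: "w \<in> lists J" and FH: "F \<in> tensor_sums S1 S2" "H \<in> tensor_sums S1 S2"
  shows "foldr PY w F \<in> tensor_sums S1 S2"
    and "foldr PY w (\<lambda>z. F z + c * H z) = (\<lambda>z. foldr PY w F z + c * foldr PY w H z)"
proof -
  have *: "foldr PY w F \<in> tensor_sums S1 S2" if "F \<in> tensor_sums S1 S2" for F
    using w by induction (auto intro: prod_basis_tensor_sums that)
  then show "foldr PY w F \<in> tensor_sums S1 S2" using FH by blast
  show "foldr PY w (\<lambda>z. F z + c * H z) = (\<lambda>z. foldr PY w F z + c * foldr PY w H z)"
    using w
  proof induction
    case (Cons i w)
    have "foldr PY w F \<in> tensor_sums S1 S2" if "F \<in> tensor_sums S1 S2" for F
      using Cons.hyps(2) by induction (auto intro: prod_basis_tensor_sums that)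
    then show ?case using prod_basis_add_scale[OF Cons.hyps(1)] Cons.IH FH by simp
  qed simp
qed

text \<open>The intersection with tensor sums is kept because there the iterated product fields are
  linear and all derivatives are square integrable.\<close>

lemma beurling_tensor_sums_add_scale:
  assumes F: "F \<in> tensor_sums S1 S2 \<inter> \<Gamma>" and H: "H \<in> tensor_sums S1 S2 \<inter> \<Gamma>"
  shows "(\<lambda>z. F z + c * H z) \<in> tensor_sums S1 S2 \<inter> \<Gamma>"
proof
  show T: "(\<lambda>z. F z + c * H z) \<in> tensor_sums S1 S2"
    using F H by (intro tensor_sums.add tensor_sums_scale) auto
  show "(\<lambda>z. F z + c * H z) \<in> \<Gamma>"
    unfolding beurling_class_def
  proof (intro CollectI conjI allI impI)
    show "(\<lambda>z. F z + c * H z) \<in> smooth_functions (n1 + n2) (prod_atlas n1 A1 A2)"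
      using tensor_sums_subset_smooth[OF F1.atlas F2.atlas] T by blast
    fix h :: real assume "0 < h"
    obtain C where C: "0 < C" "\<And>w. w \<in> lists J \<Longrightarrow>
        l2_norm (\<mu>1 \<Otimes>\<^sub>M \<mu>2) (foldr PY w F) \<le> C * h ^ length w * M (length w)"
      using beurling_class_bound[OF IntD2[OF F] \<open>0 < h\<close>] by blast
    obtain D where D: "0 < D" "\<And>w. w \<in> lists J \<Longrightarrow>
        l2_norm (\<mu>1 \<Otimes>\<^sub>M \<mu>2) (foldr PY w H) \<le> D * h ^ length w * M (length w)"
      using beurling_class_bound[OF IntD2[OF H] \<open>0 < h\<close>] by blast
    have "l2_norm (\<mu>1 \<Otimes>\<^sub>M \<mu>2) (foldr PY w (\<lambda>z. F z + c * H z))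
        \<le> (2 * C + 2 * cmod c * D) * h ^ length w * M (length w)" if w: "w \<in> lists J" for w
    proof -
      note FH = IntD1[OF F] IntD1[OF H]
      have "l2_norm (\<mu>1 \<Otimes>\<^sub>M \<mu>2) (foldr PY w (\<lambda>z. F z + c * H z))
          \<le> 2 * l2_norm (\<mu>1 \<Otimes>\<^sub>M \<mu>2) (foldr PY w F) + 2 * cmod c * l2_norm (\<mu>1 \<Otimes>\<^sub>M \<mu>2) (foldr PY w H)"
        unfolding foldr_prod_basis_add_scale(2)[OF w FH]
        by (intro l2_norm_add_scale_le tensor_sums_square_integrable foldr_prod_basis_add_scale(1)[OF w FH]
            foldr_prod_basis_add_scale(1)[OF w FH(2,1)])
      also have "\<dots> \<le> 2 * (C * h ^ length w * M (length w)) + 2 * cmod c * (D * h ^ length w * M (length w))"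
        using C(2)[OF w] D(2)[OF w] by (intro add_mono mult_left_mono) auto
      finally show ?thesis by (simp add: algebra_simps)
    qed
    then show "\<exists>C>0. \<forall>w\<in>lists J. l2_norm (\<mu>1 \<Otimes>\<^sub>M \<mu>2) (foldr PY w (\<lambda>z. F z + c * H z)) \<le> C * h ^ length w * M (length w)"
      using C(1) D(1) by (intro exI[of _ "2 * C + 2 * cmod c * D"]) (auto intro: add_pos_nonneg)
  qed
qed

text \<open>The derivatives of the first factor are measured in the square mean, those of the second
  pointwise; the geometric growth of the latter is below every Beurling bound.\<close>

lemma tensor_in_beurling:
  assumes \<phi>: "\<phi> \<in> \<Gamma>1" and \<psi>: "\<psi> \<in> S2" and L: "0 \<le> L"
    and bound: "\<And>w y. w \<in> lists {..<n2} \<Longrightarrow> cmod (foldr Y2 w \<psi> y) \<le> L ^ length w"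
  shows "tensor \<phi> \<psi> \<in> tensor_sums S1 S2 \<inter> \<Gamma>"
proof
  have \<phi>S: "\<phi> \<in> S1" using \<phi> by (simp add: group_beurling_class_def beurling_class_def)
  show T: "tensor \<phi> \<psi> \<in> tensor_sums S1 S2" by (rule tensor_sums.tensor[OF \<phi>S \<psi>])
  show "tensor \<phi> \<psi> \<in> \<Gamma>"
    unfolding beurling_class_def
  proof (intro CollectI conjI allI impI)
    show "tensor \<phi> \<psi> \<in> smooth_functions (n1 + n2) (prod_atlas n1 A1 A2)"
      using tensor_sums_subset_smooth[OF F1.atlas F2.atlas] T by blast
    fix h :: real assume h: "0 < h"
    obtain C where C: "0 < C" "\<And>w. w \<in> lists {..<n1} \<Longrightarrow>
        l2_norm \<mu>1 (foldr Y1 w \<phi>) \<le> C * h ^ length w * M (length w)"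
      using beurling_class_bound[OF \<phi>[unfolded group_beurling_class_def] h] by blast
    obtain D where D: "0 < D" "\<And>k. L ^ k \<le> D * h ^ k * M k"
      using weight_sequence_power_le[OF M L h] by blast
    have "l2_norm (\<mu>1 \<Otimes>\<^sub>M \<mu>2) (foldr PY w (tensor \<phi> \<psi>)) \<le> C * D * h ^ length w * M (length w)"
      if w: "w \<in> lists J" for w
    proof -
      obtain w1 w2 where w12: "w1 \<in> lists {..<n1}" "w2 \<in> lists {..<n2}" "length w1 + length w2 = length w"
        "foldr PY w (tensor \<phi> \<psi>) = tensor (foldr Y1 w1 \<phi>) (foldr Y2 w2 \<psi>)"
        using foldr_prod_basis_tensor[OF w \<phi>S \<psi>] .
      have "foldr Y1 w1 \<phi> \<in> S1"
        using lie_algebra_foldr_smooth[OF _ w12(1) \<phi>S, of Y1 G1] F1.basis_lie_algebra by auto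
      then have "l2_norm (\<mu>1 \<Otimes>\<^sub>M \<mu>2) (foldr PY w (tensor \<phi> \<psi>)) \<le> L ^ length w2 * l2_norm \<mu>1 (foldr Y1 w1 \<phi>)"
        unfolding w12(4) using \<mu>1 \<mu>2 bound[OF w12(2)]
        by (intro l2_norm_tensor_le smooth_square_integrable) auto
      \<comment> \<open>Both factors use the same \<open>h\<close>, so its powers combine to the
        full length and only the weights remain to be compared.\<close>
      also have "\<dots> \<le> (D * h ^ length w2 * M (length w2)) * (C * h ^ length w1 * M (length w1))"
        using C(2)[OF w12(1)] D L h weight_sequence_pos[OF M, of "length w2"] by (intro mult_mono) auto
      also have "\<dots> = C * D * h ^ length w * (M (length w1) * M (length w2))"
        by (simp add: power_add flip: w12(3))
      also have "\<dots> \<le> C * D * h ^ length w * M (length w)"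
        using C D h weight_sequence_mult_le[OF M, of "length w1" "length w2"] w12(3)
        by (intro mult_left_mono) auto
      finally show ?thesis .
    qed
    then show "\<exists>C>0. \<forall>w\<in>lists J. l2_norm (\<mu>1 \<Otimes>\<^sub>M \<mu>2) (foldr PY w (tensor \<phi> \<psi>)) \<le> C * h ^ length w * M (length w)"
      using C(1) D(1) by (intro exI[of _ "C * D"]) auto
  qed
qed

lemma zero_in_beurling: "(\<lambda>z. 0) \<in> tensor_sums S1 S2 \<inter> \<Gamma>"
proof
  have "tensor (\<lambda>x. 0) (\<lambda>y. 0) \<in> tensor_sums S1 S2"
    by (intro tensor_sums.tensor smooth_functions_const F1.atlas F2.atlas)
  moreover have "tensor (\<lambda>x. 0) (\<lambda>y. 0) = (\<lambda>z :: 'a \<times> 'b. 0)"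
    by (auto simp: tensor_def)
  ultimately show T': "(\<lambda>z. 0) \<in> tensor_sums S1 S2" by simp
  have "foldr PY w (\<lambda>z. 0) = (\<lambda>z. 0)" if "w \<in> lists J" for w
    using that
  proof induction
    case (Cons i w)
    \<comment> \<open>Linearity applied to 0 + (-1) * 0 makes the derivative cancel against
      itself.\<close>
    then show ?case
      using prod_basis_add_scale[OF Cons.hyps(1) T' T', of "-1"] by simp
  qed simp
  then show "(\<lambda>z. 0) \<in> \<Gamma>"
    using tensor_sums_subset_smooth[OF F1.atlas F2.atlas] T' weight_sequence_pos[OF M]
    by (auto simp: beurling_class_def l2_norm_def less_imp_le intro!: exI[of _ 1])
qed

section \<open>Conjugate entries as test functions\<close>

lemma tensor_conj_entry_in_beurling:
  assumes "\<phi> \<in> \<Gamma>1" "\<eta> \<in> R2" "r < rep_dim G2 \<eta>" "s < rep_dim G2 \<eta>"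
  shows "tensor \<phi> (conj_entry \<eta> s r) \<in> tensor_sums S1 S2 \<inter> \<Gamma>"
  using F2.japanese_bracket_ge_1[OF assms(2)]
  by (intro tensor_in_beurling[OF assms(1) F2.conj_entry_smooth[OF assms(2,4,3)], of "japanese_bracket \<nu>2 \<eta>"]
      F2.foldr_basis_conj_entry_le assms) auto

text \<open>Makes the conjugate entries on the first group admissible arguments of the coefficient
  estimate, which then bounds full Fourier coefficients.\<close>

lemma conj_entry_in_beurling:
  assumes "\<xi> \<in> R1" "i < rep_dim G1 \<xi>" "j < rep_dim G1 \<xi>"
  shows "conj_entry \<xi> j i \<in> \<Gamma>1"
  unfolding group_beurling_class_def beurling_class_def
proof (intro CollectI conjI allI impI)
  show S: "conj_entry \<xi> j i \<in> S1" by (rule F1.conj_entry_smooth[OF assms(1,3,2)])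
  fix h :: real assume h: "0 < h"
  obtain C where C: "0 < C" "\<And>k. japanese_bracket \<nu>1 \<xi> ^ k \<le> C * h ^ k * M k"
    using weight_sequence_power_le[OF M _ h, of "japanese_bracket \<nu>1 \<xi>"]
      F1.japanese_bracket_ge_1[OF assms(1)] by auto
  have "l2_norm \<mu>1 (foldr Y1 w (conj_entry \<xi> j i)) \<le> C * h ^ length w * M (length w)"
    if w: "w \<in> lists {..<n1}" for w
  proof -
    have "foldr Y1 w (conj_entry \<xi> j i) \<in> S1"
      using lie_algebra_foldr_smooth[OF _ w S, of Y1 G1] F1.basis_lie_algebra by auto
    then have "l2_norm \<mu>1 (foldr Y1 w (conj_entry \<xi> j i)) \<le> japanese_bracket \<nu>1 \<xi> ^ length w"
      by (intro l2_norm_le \<mu>1 smooth_square_integrable F1.foldr_basis_conj_entry_le[OF assms(1) w assms(3,2)])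
    then show ?thesis using C(2) order_trans by blast
  qed
  then show "\<exists>C>0. \<forall>w\<in>lists {..<n1}. l2_norm \<mu>1 (foldr Y1 w (conj_entry \<xi> j i)) \<le> C * h ^ length w * M (length w)"
    using C(1) by blast
qed

text \<open>Derivatives of order \<open>k\<close> are at most the \<open>k\<close>-th power of the
  bracket, so the norm is compared with the supremum defining the associated function at the bracket
  divided by \<open>h\<close>.\<close>

lemma ultra_norm_conj_entry_le:
  assumes \<xi>: "\<xi> \<in> R1" "i < rep_dim G1 \<xi>" "j < rep_dim G1 \<xi>" and h: "0 < h"
  shows "ultra_norm M {..<n1} Y1 h (conj_entry \<xi> j i)
    \<le> ennreal (exp (associated_function M (japanese_bracket \<nu>1 \<xi> / h)))"
  unfolding ultra_norm_def
proof (intro SUP_least ennreal_leI)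
  fix w x assume w: "w \<in> lists {..<n1}"
  have "cmod (foldr Y1 w (conj_entry \<xi> j i) x) / (h ^ length w * M (length w))
      \<le> japanese_bracket \<nu>1 \<xi> ^ length w / (h ^ length w * M (length w))"
    using F1.foldr_basis_conj_entry_le[OF \<xi>(1) w \<xi>(3,2)] h weight_sequence_pos[OF M, of "length w"]
    by (intro divide_right_mono) auto
  also have "\<dots> = (japanese_bracket \<nu>1 \<xi> / h) ^ length w / M (length w)"
    by (simp add: power_divide)
  also have "\<dots> \<le> exp (associated_function M (japanese_bracket \<nu>1 \<xi> / h))"
    using F1.japanese_bracket_ge_1[OF \<xi>(1)] h by (intro power_div_le_exp_associated_function[OF M]) auto
  finally show "cmod (foldr Y1 w (conj_entry \<xi> j i) x) / (h ^ length w * M (length w))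
      \<le> exp (associated_function M (japanese_bracket \<nu>1 \<xi> / h))" .
qed

text \<open>The derivative splits into orders \<open>k1\<close> and \<open>k2\<close>. Splitting
  \<open>l ^ (k1 + k2) / M (k1 + k2)\<close> accordingly leaves a term of the norm of
  \<open>\<phi>\<close> with \<open>h = 1 / l\<close> and a term of the associated function at
  \<open>l\<close> times the bracket of \<open>\<eta>\<close>.\<close>

lemma tensor_seminorm_le:
  assumes \<phi>: "\<phi> \<in> \<Gamma>1" and \<eta>: "\<eta> \<in> R2" "r < rep_dim G2 \<eta>" "s < rep_dim G2 \<eta>" and l: "0 < l"
  shows "(SUP w \<in> lists J. ennreal (l ^ length w / M (length w)) *
      (SUP x. ennreal (cmod (foldr PY w (tensor \<phi> (conj_entry \<eta> s r)) x))))
    \<le> ultra_norm M {..<n1} Y1 (1 / l) \<phi> * ennreal (exp (associated_function M (l * japanese_bracket \<nu>2 \<eta>)))"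
  \<comment> \<open>The scalar moves under the inner supremum, so that the bound can be proved for
    one word and one point.\<close>
  unfolding SUP_mult_left_ennreal
proof (intro SUP_least)
  fix w and z :: "'a \<times> 'b" assume w: "w \<in> lists J"
  note pos = weight_sequence_pos[OF M]
  let ?J = "japanese_bracket \<nu>2 \<eta>"
  have J: "1 \<le> ?J" by (rule F2.japanese_bracket_ge_1[OF \<eta>(1)])
  have "\<phi> \<in> S1" using \<phi> by (simp add: group_beurling_class_def beurling_class_def)
  then obtain w1 w2 where w12: "w1 \<in> lists {..<n1}" "w2 \<in> lists {..<n2}" "length w1 + length w2 = length w"
    "foldr PY w (tensor \<phi> (conj_entry \<eta> s r)) = tensor (foldr Y1 w1 \<phi>) (foldr Y2 w2 (conj_entry \<eta> s r))"
    using foldr_prod_basis_tensor[OF w _ F2.conj_entry_smooth[OF \<eta>(1,3,2)]] by blast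
  let ?k1 = "length w1" and ?k2 = "length w2"
  define a where "a = cmod (foldr Y1 w1 \<phi> (fst z))"
  have a: "0 \<le> a" by (simp add: a_def)
  have "foldr PY w (tensor \<phi> (conj_entry \<eta> s r)) z
      = foldr Y1 w1 \<phi> (fst z) * foldr Y2 w2 (conj_entry \<eta> s r) (snd z)"
    unfolding w12(4) by (simp add: tensor_def split_beta)
  then have "cmod (foldr PY w (tensor \<phi> (conj_entry \<eta> s r)) z) \<le> a * ?J ^ ?k2"
    unfolding a_def
    using F2.foldr_basis_conj_entry_le[OF \<eta>(1) w12(2) \<eta>(3,2)] by (simp add: norm_mult mult_left_mono)
  then have "l ^ length w / M (length w) * cmod (foldr PY w (tensor \<phi> (conj_entry \<eta> s r)) z)
      \<le> l ^ length w / M (length w) * (a * ?J ^ ?k2)"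
    using l pos[of "length w"] by (intro mult_left_mono) auto
  \<comment> \<open>Replacing \<open>M (length w)\<close> by the smaller product of weights
    separates the two factors.\<close>
  also have "\<dots> \<le> l ^ length w / (M ?k1 * M ?k2) * (a * ?J ^ ?k2)"
    using weight_sequence_mult_le[OF M, of ?k1 ?k2] l J a pos[of ?k1] pos[of ?k2] pos[of "length w"]
    by (intro mult_right_mono divide_left_mono) (auto simp: w12(3))
  also have "\<dots> = a / ((1 / l) ^ ?k1 * M ?k1) * ((l * ?J) ^ ?k2 / M ?k2)"
    using l by (simp add: power_mult_distrib power_add power_one_over field_simps flip: w12(3))
  also have "\<dots> \<le> a / ((1 / l) ^ ?k1 * M ?k1) * exp (associated_function M (l * ?J))"
    using l J a pos[of ?k1] by (intro mult_left_mono power_div_le_exp_associated_function[OF M]) auto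
  finally have "ennreal (l ^ length w / M (length w) * cmod (foldr PY w (tensor \<phi> (conj_entry \<eta> s r)) z))
      \<le> ennreal (a / ((1 / l) ^ ?k1 * M ?k1)) * ennreal (exp (associated_function M (l * ?J)))"
    using l a pos[of ?k1] by (subst ennreal_mult[symmetric]) (auto intro: ennreal_leI)
  also have "ennreal (a / ((1 / l) ^ ?k1 * M ?k1)) \<le> ultra_norm M {..<n1} Y1 (1 / l) \<phi>"
    unfolding ultra_norm_def a_def by (intro SUP_upper2[OF w12(1)] SUP_upper UNIV_I)
  finally show "ennreal (l ^ length w / M (length w)) * ennreal (cmod (foldr PY w (tensor \<phi> (conj_entry \<eta> s r)) z))
      \<le> ultra_norm M {..<n1} Y1 (1 / l) \<phi> * ennreal (exp (associated_function M (l * ?J)))"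
    using l pos[of "length w"] by (subst ennreal_mult[symmetric]) (auto simp: mult_right_mono)
qed


section \<open>Partial Fourier coefficients\<close>

abbreviation "fourier_span \<equiv> partial_fourier_span \<Gamma>1 G2 R2"

text \<open>The estimate of the theorem with its three constants exposed, so that it can be
  transported between \<open>u\<close> and an ultradistribution.\<close>

abbreviation "coefficient_bound u \<equiv> \<lambda>\<epsilon> h C. \<forall>\<phi> \<in> \<Gamma>1. \<forall>\<eta>\<in>R2. \<forall>r < rep_dim G2 \<eta>. \<forall>s < rep_dim G2 \<eta>.
  ennreal (cmod (partial_fourier_coeff u \<eta> r s \<phi>)) \<le>
    ennreal C * ultra_norm M {..<n1} Y1 h \<phi> *
    ennreal (exp (associated_function M (\<epsilon> * japanese_bracket \<nu>2 \<eta>)))"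

text \<open>Ensures that an ultradistribution on the product is linear on the span.\<close>

lemma span_subset_beurling: "f \<in> fourier_span \<Longrightarrow> f \<in> \<Gamma>"
proof -
  assume "f \<in> fourier_span"
  then obtain k :: nat and c g where f: "f = (\<lambda>x. \<Sum>i<k. c i * g i x)"
    and g: "\<And>i. i < k \<Longrightarrow> \<exists>\<phi> \<eta> r s. g i = tensor \<phi> (conj_entry \<eta> s r) \<and> \<phi> \<in> \<Gamma>1 \<and> \<eta> \<in> R2
      \<and> r < rep_dim G2 \<eta> \<and> s < rep_dim G2 \<eta>"
    unfolding partial_fourier_span_def complex_span_def by blast
  have g: "g i \<in> tensor_sums S1 S2 \<inter> \<Gamma>" if "i < k" for i
  proof -
    from g[OF that] obtain \<phi> \<eta> r s where "g i = tensor \<phi> (conj_entry \<eta> s r)"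
      and *: "\<phi> \<in> \<Gamma>1" "\<eta> \<in> R2" "r < rep_dim G2 \<eta>" "s < rep_dim G2 \<eta>" by blast
    then show ?thesis using tensor_conj_entry_in_beurling[OF *] by (simp only:)
  qed
  \<comment> \<open>Induction on the number of terms; the intersection with tensor sums is the
    invariant that permits adding one more.\<close>
  have "(\<lambda>x. \<Sum>i<m. c i * g i x) \<in> tensor_sums S1 S2 \<inter> \<Gamma>" if "m \<le> k" for m
    using that
  proof (induction m)
    case (Suc m)
    then show ?case
      using beurling_tensor_sums_add_scale[OF _ g[of m], of "\<lambda>x. \<Sum>i<m. c i * g i x" "c m"] by simp
  qed (simp only: lessThan_0 sum.empty zero_in_beurling)
  then show "f \<in> \<Gamma>" unfolding f by blast
qed

lemma tensor_in_span:
  assumes "\<phi> \<in> \<Gamma>1" "\<eta> \<in> R2" "r < rep_dim G2 \<eta>" "s < rep_dim G2 \<eta>"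
  shows "tensor \<phi> (conj_entry \<eta> s r) \<in> fourier_span"
proof -
  have "tensor \<phi> (conj_entry \<eta> s r) \<in> {tensor \<phi> (conj_entry \<eta> s r) | \<phi> \<eta> r s.
      \<phi> \<in> \<Gamma>1 \<and> \<eta> \<in> R2 \<and> r < rep_dim G2 \<eta> \<and> s < rep_dim G2 \<eta>}" using assms by blast
  from complex_spanI[of 1 "\<lambda>_. tensor \<phi> (conj_entry \<eta> s r)", OF this, of "\<lambda>_. 1"]
  show ?thesis unfolding partial_fourier_span_def by simp
qed

text \<open>Both functionals are linear on the span only, so generators, their multiples and partial
  sums are first shown to lie in it.\<close>

lemma linear_on_span_eqI:
  assumes u: "linear_on fourier_span u" and v: "linear_on fourier_span v"
    and eq: "\<And>\<phi> \<eta> r s. \<phi> \<in> \<Gamma>1 \<Longrightarrow> \<eta> \<in> R2 \<Longrightarrow> r < rep_dim G2 \<eta> \<Longrightarrow> s < rep_dim G2 \<eta> \<Longrightarrow>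
      u (tensor \<phi> (conj_entry \<eta> s r)) = v (tensor \<phi> (conj_entry \<eta> s r))"
    and f: "f \<in> fourier_span"
  shows "u f = v f"
proof -
  define B where "B = {tensor \<phi> (conj_entry \<eta> s r) | \<phi> \<eta> r s.
    \<phi> \<in> \<Gamma>1 \<and> \<eta> \<in> R2 \<and> r < rep_dim G2 \<eta> \<and> s < rep_dim G2 \<eta>}"
  have span: "fourier_span = complex_span B" by (simp add: partial_fourier_span_def B_def)
  obtain k :: nat and c g where f: "f = (\<lambda>x. \<Sum>i<k. c i * g i x)" and g: "\<And>i. i < k \<Longrightarrow> g i \<in> B"
    using f unfolding span complex_span_def by blast
  have partial: "(\<lambda>x. \<Sum>i<m. c i * g i x) \<in> fourier_span" if "m \<le> k" for m c
    unfolding span using g that by (intro complex_spanI) auto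
  have zero: "(\<lambda>x. 0) \<in> fourier_span" using partial[of 0 c] by simp
  have scale: "(\<lambda>x. a * g i x) \<in> fourier_span" if "i < k" for a i
    unfolding span using g[OF that] complex_spanI[of 1 "\<lambda>_. g i" B "\<lambda>_. a"] by simp
  have mem: "g i \<in> fourier_span" if "i < k" for i using scale[OF that, of 1] by simp
  have "u f = (\<Sum>i<k. c i * u (g i))"
    unfolding f by (rule linear_on_sum[OF u zero partial mem scale])
  also have "\<dots> = (\<Sum>i<k. c i * v (g i))"
  proof (intro sum.cong refl arg_cong2[where f = "(*)"])
    fix i assume "i \<in> {..<k}"
    then have "g i \<in> B" using g by simp
    then obtain \<phi> \<eta> r s where "g i = tensor \<phi> (conj_entry \<eta> s r)"
      and *: "\<phi> \<in> \<Gamma>1" "\<eta> \<in> R2" "r < rep_dim G2 \<eta>" "s < rep_dim G2 \<eta>" unfolding B_def by blast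
    then show "u (g i) = v (g i)" using eq[OF *] by (simp only:)
  qed
  also have "\<dots> = v f"
    unfolding f by (rule linear_on_sum[OF v zero partial mem scale, symmetric])
  finally show ?thesis .
qed

text \<open>The continuity parameter \<open>l\<close> yields \<open>\<epsilon> = l\<close> and
  \<open>h = 1 / l\<close> with the same \<open>C\<close>. Besides the direct implication, this also
  serves the converse, where it is applied to the ultradistribution built from the
  coefficients.\<close>

lemma prod_ultradistribution_bound:
  assumes v: "v \<in> prod_ultradistributions M n1 A1 \<mu>1 Y1 n2 A2 \<mu>2 Y2"
  shows "\<exists>\<epsilon>>0. \<exists>h>0. \<exists>C>0. coefficient_bound v \<epsilon> h C"
proof -
  obtain l C where lC: "0 < l" "0 < C" "\<And>\<psi>. \<psi> \<in> \<Gamma> \<Longrightarrow> ennreal (cmod (v \<psi>)) \<le> ennreal C * (SUP w \<in> lists J.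
      ennreal (l ^ length w / M (length w)) * (SUP x. ennreal (cmod (foldr PY w \<psi> x))))"
    using v unfolding prod_ultradistributions_def ultradistributions_def by auto
  have "ennreal (cmod (partial_fourier_coeff v \<eta> r s \<phi>)) \<le>
      ennreal C * ultra_norm M {..<n1} Y1 (1 / l) \<phi> * ennreal (exp (associated_function M (l * japanese_bracket \<nu>2 \<eta>)))"
    if "\<phi> \<in> \<Gamma>1" "\<eta> \<in> R2" "r < rep_dim G2 \<eta>" "s < rep_dim G2 \<eta>" for \<phi> \<eta> r s
    unfolding partial_fourier_coeff_def mult.assoc
    using order_trans[OF lC(3)[OF IntD2[OF tensor_conj_entry_in_beurling[OF that]]]
        mult_left_mono[OF tensor_seminorm_le[OF that lC(1)] zero_le]] .
  then show ?thesis
    using lC(1,2) by (intro exI[of _ l] exI[of _ "1 / l"] exI[of _ C] conjI ballI allI impI) auto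
qed

text \<open>For fixed \<open>\<eta>\<close> the exponential is a constant and joins
  \<open>C\<close>; what remains is continuity with parameter \<open>1 / h\<close>. Only values on
  the span enter, so this covers \<open>u\<close> as well as an ultradistribution on the
  product.\<close>

lemma partial_fourier_coeff_ultradistribution:
  assumes u: "linear_on fourier_span u" and bound: "coefficient_bound u \<epsilon> h C" and pos: "0 < h" "0 < C"
    and \<eta>: "\<eta> \<in> R2" "r < rep_dim G2 \<eta>" "s < rep_dim G2 \<eta>"
  shows "partial_fourier_coeff u \<eta> r s \<in> group_ultradistributions M n1 A1 \<mu>1 Y1"
  unfolding group_ultradistributions_def ultradistributions_def group_beurling_class_def[symmetric]
proof (intro CollectI conjI)
  show "linear_on \<Gamma>1 (partial_fourier_coeff u \<eta> r s)"
    unfolding linear_on_def partial_fourier_coeff_def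
  proof (intro conjI ballI allI)
    fix f c assume f: "f \<in> \<Gamma>1"
    have "tensor (\<lambda>x. c * f x) (conj_entry \<eta> s r) = (\<lambda>x. c * tensor f (conj_entry \<eta> s r) x)"
      by (simp add: tensor_def fun_eq_iff)
    then show "u (tensor (\<lambda>x. c * f x) (conj_entry \<eta> s r)) = c * u (tensor f (conj_entry \<eta> s r))"
      using u tensor_in_span[OF f \<eta>] unfolding linear_on_def by simp
    fix g assume g: "g \<in> \<Gamma>1"
    have "tensor (\<lambda>x. f x + g x) (conj_entry \<eta> s r)
        = (\<lambda>x. tensor f (conj_entry \<eta> s r) x + tensor g (conj_entry \<eta> s r) x)"
      by (simp add: tensor_def fun_eq_iff distrib_right)
    then show "u (tensor (\<lambda>x. f x + g x) (conj_entry \<eta> s r))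
        = u (tensor f (conj_entry \<eta> s r)) + u (tensor g (conj_entry \<eta> s r))"
      using u tensor_in_span[OF f \<eta>] tensor_in_span[OF g \<eta>] unfolding linear_on_def by simp
  qed
  let ?E = "exp (associated_function M (\<epsilon> * japanese_bracket \<nu>2 \<eta>))"
  have "ennreal (cmod (partial_fourier_coeff u \<eta> r s \<psi>)) \<le> ennreal (C * ?E) * (SUP w \<in> lists {..<n1}.
      ennreal ((1 / h) ^ length w / M (length w)) * (SUP x. ennreal (cmod (foldr Y1 w \<psi> x))))"
    if "\<psi> \<in> \<Gamma>1" for \<psi>
  proof -
    have "ennreal (cmod (partial_fourier_coeff u \<eta> r s \<psi>)) \<le> ennreal C * ultra_norm M {..<n1} Y1 h \<psi> * ennreal ?E"
      using bound that \<eta> by blast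
    also have "\<dots> = ennreal (C * ?E) * ultra_norm M {..<n1} Y1 h \<psi>"
      using pos by (simp add: ennreal_mult mult_ac)
    finally show ?thesis unfolding ultra_norm_eq[OF M pos(1)] .
  qed
  then show "\<exists>l>0. \<exists>C>0. \<forall>\<psi>\<in>\<Gamma>1. ennreal (cmod (partial_fourier_coeff u \<eta> r s \<psi>)) \<le>
      ennreal C * (SUP w\<in>lists {..<n1}. ennreal (l ^ length w / M (length w)) * (SUP x. ennreal (cmod (foldr Y1 w \<psi> x))))"
    using pos by (intro exI[of _ "1 / h"] exI[of _ "C * ?E"] conjI ballI) auto
qed

text \<open>Testing with conjugate entries of \<open>\<xi>\<close> gives a product of two
  exponentials, merged by (M.2). This leads to \<open>N = H * (1 / h + \<epsilon>)\<close> and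
  \<open>D = C * B\<close>.\<close>

lemma fourier_coeff_le:
  assumes bound: "coefficient_bound u \<epsilon> h C" and pos: "0 < \<epsilon>" "0 < h" "0 < C"
  shows "\<exists>N>0. \<exists>D>0. \<forall>\<xi>\<in>R1. \<forall>\<eta>\<in>R2.
    \<forall>i < rep_dim G1 \<xi>. \<forall>j < rep_dim G1 \<xi>. \<forall>r < rep_dim G2 \<eta>. \<forall>s < rep_dim G2 \<eta>.
      cmod (u (tensor (conj_entry \<xi> j i) (conj_entry \<eta> s r))) \<le>
        D * exp (associated_function M (N * (japanese_bracket \<nu>1 \<xi> + japanese_bracket \<nu>2 \<eta>)))"
proof -
  obtain B H where BH: "1 \<le> B" "0 < H" "\<And>r s t. 0 < r \<Longrightarrow> 0 < s \<Longrightarrow> r \<le> t \<Longrightarrow> s \<le> t \<Longrightarrow>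
      exp (associated_function M r) * exp (associated_function M s) \<le> B * exp (associated_function M (H * t))"
    using exp_associated_function_mult_le[OF M] by blast
  have "cmod (u (tensor (conj_entry \<xi> j i) (conj_entry \<eta> s r))) \<le>
      (C * B) * exp (associated_function M (H * (1 / h + \<epsilon>) * (japanese_bracket \<nu>1 \<xi> + japanese_bracket \<nu>2 \<eta>)))"
    if \<xi>: "\<xi> \<in> R1" "i < rep_dim G1 \<xi>" "j < rep_dim G1 \<xi>"
      and \<eta>: "\<eta> \<in> R2" "r < rep_dim G2 \<eta>" "s < rep_dim G2 \<eta>" for \<xi> \<eta> i j r s
  proof -
    let ?a = "japanese_bracket \<nu>1 \<xi>" and ?b = "japanese_bracket \<nu>2 \<eta>"
    have ab: "1 \<le> ?a" "1 \<le> ?b"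
      using F1.japanese_bracket_ge_1[OF \<xi>(1)] F2.japanese_bracket_ge_1[OF \<eta>(1)] by auto
    have "ennreal (cmod (u (tensor (conj_entry \<xi> j i) (conj_entry \<eta> s r))))
        \<le> ennreal C * ultra_norm M {..<n1} Y1 h (conj_entry \<xi> j i) * ennreal (exp (associated_function M (\<epsilon> * ?b)))"
      using bound conj_entry_in_beurling[OF \<xi>] \<eta> unfolding partial_fourier_coeff_def by blast
    also have "\<dots> \<le> ennreal C * ennreal (exp (associated_function M (?a / h))) * ennreal (exp (associated_function M (\<epsilon> * ?b)))"
      by (intro mult_mono ultra_norm_conj_entry_le[OF \<xi> pos(2)]) auto
    also have "\<dots> = ennreal (C * (exp (associated_function M (?a / h)) * exp (associated_function M (\<epsilon> * ?b))))"
      using pos by (simp add: ennreal_mult mult.assoc)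
    finally have "cmod (u (tensor (conj_entry \<xi> j i) (conj_entry \<eta> s r)))
        \<le> C * (exp (associated_function M (?a / h)) * exp (associated_function M (\<epsilon> * ?b)))"
      using pos by (subst (asm) ennreal_le_iff) auto
    also have "\<dots> \<le> C * (B * exp (associated_function M (H * ((1 / h + \<epsilon>) * (?a + ?b)))))"
    proof (intro mult_left_mono BH(3))
      \<comment> \<open>The common upper bound of both arguments is
        \<open>(1 / h + \<epsilon>) * (?a + ?b)\<close>.\<close>
      have "?a / h \<le> (?a + ?b) / h" "0 \<le> \<epsilon> * (?a + ?b)" "\<epsilon> * ?b \<le> \<epsilon> * (?a + ?b)" "0 \<le> (?a + ?b) / h"
        using ab pos by (auto intro: divide_right_mono)
      then show "?a / h \<le> (1 / h + \<epsilon>) * (?a + ?b)" "\<epsilon> * ?b \<le> (1 / h + \<epsilon>) * (?a + ?b)"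
        by (simp_all only: distrib_right times_divide_eq_left mult_1)
    qed (use ab pos in auto)
    finally show ?thesis by (simp add: mult.assoc)
  qed
  moreover have "0 < H * (1 / h + \<epsilon>)" "0 < C * B"
    using pos BH by (auto intro!: mult_pos_pos add_pos_pos)
  ultimately show ?thesis by blast
qed

lemma linear_on_span_if_prod_ultradistribution:
  assumes "v \<in> prod_ultradistributions M n1 A1 \<mu>1 Y1 n2 A2 \<mu>2 Y2"
  shows "linear_on fourier_span v"
proof -
  have "linear_on \<Gamma> v"
    using assms unfolding prod_ultradistributions_def ultradistributions_def by blast
  then show ?thesis
    unfolding linear_on_def using span_subset_beurling by blast
qed

end

section \<open>Extendability and the estimate of partial Fourier coefficients\<close>

theorem theorem3p6:
  fixes G1 :: "'a::{second_countable_topology, t2_space} monoid"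
    and G2 :: "'b::{second_countable_topology, t2_space} monoid"
    and n1 n2 :: nat
    and A1 :: "'a chart set" and A2 :: "'b chart set"
    and \<mu>1 :: "'a measure" and \<mu>2 :: "'b measure"
    and ip1 :: "'a operator \<Rightarrow> 'a operator \<Rightarrow> real"
    and ip2 :: "'b operator \<Rightarrow> 'b operator \<Rightarrow> real"
    and Y1 :: "nat \<Rightarrow> 'a operator" and Y2 :: "nat \<Rightarrow> 'b operator"
    and R1 :: "('a \<Rightarrow> complex mat) set" and R2 :: "('b \<Rightarrow> complex mat) set"
    and \<nu>1 :: "('a \<Rightarrow> complex mat) \<Rightarrow> real" and \<nu>2 :: "('b \<Rightarrow> complex mat) \<Rightarrow> real"
    and M :: "nat \<Rightarrow> real"
    and u :: "('a \<times> 'b \<Rightarrow> complex) \<Rightarrow> complex"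
  assumes M: "weight_sequence M"
    and G1: "compact_lie_group_fourier G1 n1 A1 \<mu>1 ip1 Y1 R1 \<nu>1"
    and G2: "compact_lie_group_fourier G2 n2 A2 \<mu>2 ip2 Y2 R2 \<nu>2"
    and determined: "determined_by_fourier_coeffs (group_beurling_class M n1 A1 \<mu>1 Y1)
          (group_ultradistributions M n1 A1 \<mu>1 Y1) G1 R1"
    and characterization: "prod_fourier_characterization M
          (prod_ultradistributions M n1 A1 \<mu>1 Y1 n2 A2 \<mu>2 Y2) G1 R1 \<nu>1 G2 R2 \<nu>2"
    and u: "linear_on (partial_fourier_span (group_beurling_class M n1 A1 \<mu>1 Y1) G2 R2) u"
  shows "(\<exists>v \<in> prod_ultradistributions M n1 A1 \<mu>1 Y1 n2 A2 \<mu>2 Y2.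
            \<forall>f \<in> partial_fourier_span (group_beurling_class M n1 A1 \<mu>1 Y1) G2 R2. u f = v f) \<longleftrightarrow>
    (\<exists>\<epsilon>>0. \<exists>h>0. \<exists>C>0. \<forall>\<phi> \<in> group_beurling_class M n1 A1 \<mu>1 Y1.
       \<forall>\<eta>\<in>R2. \<forall>r < rep_dim G2 \<eta>. \<forall>s < rep_dim G2 \<eta>.
         ennreal (cmod (partial_fourier_coeff u \<eta> r s \<phi>)) \<le>
           ennreal C * ultra_norm M {..<n1} Y1 h \<phi> *
           ennreal (exp (associated_function M (\<epsilon> * japanese_bracket \<nu>2 \<eta>))))"
proof -
  interpret compact_lie_group_fourier_pair G1 n1 A1 \<mu>1 ip1 Y1 R1 \<nu>1 G2 n2 A2 \<mu>2 ip2 Y2 R2 \<nu>2 M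
    by (intro compact_lie_group_fourier_pair.intro compact_lie_group_fourier_pair_axioms.intro G1 G2 M)
  let ?\<Gamma>' = "prod_ultradistributions M n1 A1 \<mu>1 Y1 n2 A2 \<mu>2 Y2"
  show ?thesis
  proof
    assume "\<exists>v \<in> ?\<Gamma>'. \<forall>f \<in> fourier_span. u f = v f"
    then obtain v where v: "v \<in> ?\<Gamma>'" "\<And>f. f \<in> fourier_span \<Longrightarrow> u f = v f" by blast
    obtain \<epsilon> h C where pos: "0 < \<epsilon>" "0 < h" "0 < C" and bound: "coefficient_bound v \<epsilon> h C"
      using prod_ultradistribution_bound[OF v(1)] by blast
    have "coefficient_bound u \<epsilon> h C"
      using bound tensor_in_span by (simp add: partial_fourier_coeff_def v(2))
    with pos show "\<exists>\<epsilon>>0. \<exists>h>0. \<exists>C>0. coefficient_bound u \<epsilon> h C" by blast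
  next
    assume "\<exists>\<epsilon>>0. \<exists>h>0. \<exists>C>0. coefficient_bound u \<epsilon> h C"
    then obtain \<epsilon> h C where pos: "0 < \<epsilon>" "0 < h" "0 < C" and bound: "coefficient_bound u \<epsilon> h C" by blast
    \<comment> \<open>The characterization is applied to the family of values of \<open>u\<close>
      itself on tensors of conjugate entries.\<close>
    obtain v where v: "v \<in> ?\<Gamma>'" and coeff: "\<And>\<xi> \<eta> i j r s. \<xi> \<in> R1 \<Longrightarrow> \<eta> \<in> R2 \<Longrightarrow>
        i < rep_dim G1 \<xi> \<Longrightarrow> j < rep_dim G1 \<xi> \<Longrightarrow> r < rep_dim G2 \<eta> \<Longrightarrow> s < rep_dim G2 \<eta> \<Longrightarrow>
        v (tensor (conj_entry \<xi> j i) (conj_entry \<eta> s r)) = u (tensor (conj_entry \<xi> j i) (conj_entry \<eta> s r))"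
      using iffD2[OF spec[OF characterization[unfolded prod_fourier_characterization_def],
            of "\<lambda>\<xi> \<eta> i j r s. u (tensor (conj_entry \<xi> j i) (conj_entry \<eta> s r))"]
          fourier_coeff_le[OF bound pos]] by blast
    note v_linear = linear_on_span_if_prod_ultradistribution[OF v]
    \<comment> \<open>The direct implication applied to \<open>v\<close>: it makes the partial
      coefficients of \<open>v\<close> ultradistributions on the first group too.\<close>
    obtain \<delta> h' C' where pos': "0 < h'" "0 < C'" and bound': "coefficient_bound v \<delta> h' C'"
      using prod_ultradistribution_bound[OF v] by blast
    have "u (tensor \<phi> (conj_entry \<eta> s r)) = v (tensor \<phi> (conj_entry \<eta> s r))"
      if \<phi>: "\<phi> \<in> \<Gamma>1" and \<eta>: "\<eta> \<in> R2" "r < rep_dim G2 \<eta>" "s < rep_dim G2 \<eta>" for \<phi> \<eta> r s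
    proof -
      have "partial_fourier_coeff u \<eta> r s \<phi> = partial_fourier_coeff v \<eta> r s \<phi>"
      \<comment> \<open>Uniqueness on the first group, for fixed \<open>\<eta>\<close>,
        \<open>r\<close>, \<open>s\<close>, extends the equality from conjugate entries to every
        \<open>\<phi>\<close> in the Beurling class.\<close>
      proof (rule determined[unfolded determined_by_fourier_coeffs_def, rule_format, OF _ _ _ \<phi>])
        show "partial_fourier_coeff u \<eta> r s \<in> group_ultradistributions M n1 A1 \<mu>1 Y1"
          by (rule partial_fourier_coeff_ultradistribution[OF u bound pos(2,3) \<eta>])
        show "partial_fourier_coeff v \<eta> r s \<in> group_ultradistributions M n1 A1 \<mu>1 Y1"
          by (rule partial_fourier_coeff_ultradistribution[OF v_linear bound' pos' \<eta>])
      qed (simp add: partial_fourier_coeff_def coeff \<eta>)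
      then show ?thesis by (simp add: partial_fourier_coeff_def)
    qed
    then have "u f = v f" if "f \<in> fourier_span" for f
      using linear_on_span_eqI[OF u v_linear _ that] by blast
    with v show "\<exists>v \<in> ?\<Gamma>'. \<forall>f \<in> fourier_span. u f = v f" by blast
  qed
qed

end
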